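(* Let $p_1>p_2>\cdots>p_L$ be distinct primes, let $D=p_1\cdots p_L$, and let $t\in(1,\infty]$. The infimum in $M_t(\sqrt D)$ is attained in $\mathbb{Q}(\sqrt D)$ if and only if $D<p_1^2$. In this situation, the infimum is attained by the points $\sqrt{\frac{p_1}{p_2\cdots p_L}},\,p_2,\,\ldots,\,p_L\in\mathbb{Q}(\sqrt D)$, and $M_t(\sqrt D)=\left(\sum_{\ell=1}^L(\log p_\ell)^t\right)^{1/t}$ if $t\in(1,\infty)$, while $M_\infty(\sqrt D)=\log p_1$.
   Context: For a polynomial $f(z)=a\prod_{n=1}^N(z-\beta_n)\in\mathbb{C}[z]$, its (logarithmic) Mahler measure is $M(f)=\log|a|+\sum_{n=1}^N\log^+|\beta_n|$, where $\log^+x=\max\{0,\log x\}$. For a non-zero algebraic number $\beta$, $M(\beta)$ is the Mahler measure of the minimal polynomial of $\beta$ over $\mathbb{Z}$. For $t\in[1,\infty)$ and $\beta\in\overline{\mathbb{Q}}^\times$, $M_t(\beta)=\inf\{(\sum_{n=1}^N M(\beta_n)^t)^{1/t}: N\in\mathbb{N},\ \beta_n\in\overline{\mathbb{Q}}^\times,\ \beta=\prod_{n=1}^N\beta_n\}$, and $M_\infty(\beta)=\inf\{\max_{1\le n\le N}M(\beta_n): N\in\mathbb{N},\ \beta_n\in\overline{\mathbb{Q}}^\times,\ \beta=\prod_{n=1}^N\beta_n\}$. The infimum in $M_t(\beta)$ is attained by $\beta_1,\ldots,\beta_N$ if $\beta=\beta_1\cdots\beta_N$ and $M_t(\beta)$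 equals $(\sum_n M(\beta_n)^t)^{1/t}$ (for $t<\infty$) or $\max_n M(\beta_n)$ (for $t=\infty$); it is attained in a set $S\subseteq\overline{\mathbb{Q}}$ if it is attained by some points $\beta_1,\ldots,\beta_N\in S$. *)

theory Defs
  imports
    "HOL-Computational_Algebra.Computational_Algebra"
    "HOL-Library.Extended_Real"
begin

abbreviation cpoly :: "int poly \<Rightarrow> complex poly" where
  "cpoly f \<equiv> map_poly of_int f"

text \<open>Since \<open>ln 0 = 0\<close> in HOL, a root \<open>0\<close> contributes \<open>0\<close>, as it should.\<close>

definition log_mahler :: "complex poly \<Rightarrow> real" where
  "log_mahler f = ln (cmod (lead_coeff f)) + (\<Sum>\<beta>\<in>#proots f. max 0 (ln (cmod \<beta>)))"

definition is_min_int_poly :: "complex \<Rightarrow> int poly \<Rightarrow> bool" where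
  "is_min_int_poly \<beta> f \<longleftrightarrow> irreducible f \<and> lead_coeff f > 0 \<and> poly (cpoly f) \<beta> = 0"

definition min_int_poly :: "complex \<Rightarrow> int poly" where
  "min_int_poly \<beta> = (THE f. is_min_int_poly \<beta> f)"

lemma cpoly_mult: "cpoly (f * g) = cpoly f * cpoly g"
  by (rule poly_eqI) (simp add: coeff_map_poly coeff_mult)

lemma cpoly_add: "cpoly (f + g) = cpoly f + cpoly g"
  by (rule poly_eqI) (simp add: coeff_map_poly)

lemma ex_irreducible_root_factor:
  fixes p :: "int poly"
  assumes "p \<noteq> 0" and "poly (cpoly p) \<beta> = 0"
  shows "\<exists>h. irreducible h \<and> h dvd p \<and> poly (cpoly h) \<beta> = 0"
  using assms
proof (induction p rule: prime_divisors_induct)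
  case zero
  then show ?case by simp
next
  case (unit x)
  then obtain y where y: "1 = x * y" by (auto elim: dvdE)
  have "poly (cpoly (x * y)) \<beta> = 1" by (simp flip: y)
  with unit show ?case by (simp add: cpoly_mult)
next
  case (factor q x)
  have irr: "irreducible q"
    using factor.hyps by (intro prime_elem_imp_irreducible) (auto simp: prime_def)
  show ?case
  proof (cases "poly (cpoly q) \<beta> = 0")
    case True
    then show ?thesis using irr by auto
  next
    case False
    then show ?thesis using factor by (auto simp: cpoly_mult)
  qed
qed

lemma ex1_is_min_int_poly:
  assumes "algebraic \<beta>"
  shows "\<exists>!f. is_min_int_poly \<beta> f"
proof -
  define P where "P = (\<lambda>f. f \<noteq> 0 \<and> poly (cpoly f) \<beta> = 0)"
  obtain f0 where "P f0" using assms unfolding P_def by (elim algebraicE') auto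
  then obtain g where g: "P g" and g_min: "\<And>f. P f \<Longrightarrow> degree g \<le> degree f"
    using exists_least_iff[of "\<lambda>n. \<exists>f. P f \<and> degree f = n"] by (metis not_le)
  obtain h where h: "irreducible h" "h dvd g" "poly (cpoly h) \<beta> = 0"
    using ex_irreducible_root_factor[of g \<beta>] g unfolding P_def by blast
  have h0: "h \<noteq> 0" using h(1) by auto
  have h_min: "degree h \<le> degree f" if "P f" for f
    using dvd_imp_degree_le[OF h(2)] g g_min[OF that] by (auto simp: P_def)
  have h_deg: "degree h > 0"
  proof (rule ccontr)
    assume "\<not> degree h > 0"
    then obtain c where "h = [:c:]" by (auto elim: degree_eq_zeroE)
    with h h0 show False by (simp add: map_poly_pCons)
  qed
  have assoc: "h dvd f \<and> f dvd h" if f: "irreducible f" "poly (cpoly f) \<beta> = 0" for f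
  proof -
    define r where "r = pseudo_mod f h"
    obtain a q where a: "a \<noteq> 0" "smult a f = h * q + r"
      and r: "r = 0 \<or> degree r < degree h"
      using pseudo_mod[OF h0, of f] unfolding r_def by blast
    have "poly (cpoly ([:a:] * f)) \<beta> = 0" by (simp only: cpoly_mult poly_mult f(2)) simp
    then have "poly (cpoly r) \<beta> = 0"
      using a(2) h(3) by (simp add: cpoly_mult cpoly_add)
    with r h_min[of r] have "r = 0" unfolding P_def by linarith
    with a have "h dvd [:a:] * f" by simp
    moreover have "prime_elem h" using h(1) by (rule irreducible_imp_prime_elem)
    moreover have "\<not> h dvd [:a:]"
      using dvd_imp_degree_le[of h "[:a:]"] a(1) h_deg by auto
    ultimately have hf: "h dvd f" by (blast dest: prime_elem_dvd_multD)
    with f(1) h(1) have "f dvd h" by (blast dest: irreducibleD' irreducible_not_unit)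
    with hf show ?thesis ..
  qed
  show ?thesis
  proof (rule ex_ex1I)
    show "\<exists>f. is_min_int_poly \<beta> f"
    proof (cases "lead_coeff h > 0")
      case True
      with h show ?thesis by (auto simp: is_min_int_poly_def)
    next
      case False
      then have "lead_coeff (- h) > 0" using h0 by (simp add: less_le)
      moreover have "cpoly (- h) = - cpoly h" by (rule poly_eqI) (simp add: coeff_map_poly)
      moreover have "irreducible (- h)"
        using h(1) irreducible_mult_unit_left[of "- 1" h] by simp
      ultimately show ?thesis using h by (auto simp: is_min_int_poly_def intro!: exI[of _ "- h"])
    qed
  next
    fix f g assume fg: "is_min_int_poly \<beta> f" "is_min_int_poly \<beta> g"
    then have "h dvd f" "f dvd h" "h dvd g" "g dvd h"
      using assoc unfolding is_min_int_poly_def by blast+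
    then have dvd: "f dvd g" "g dvd f" by (blast intro: dvd_trans)+
    have norm: "normalize x = x" if "lead_coeff x > 0" for x :: "int poly"
    proof -
      have "unit_factor x = 1"
        using that by (simp add: unit_factor_poly_def monom_0 one_pCons)
      then show ?thesis by (metis div_by_1 div_unit_factor)
    qed
    have "normalize f = f" "normalize g = g"
      using fg norm unfolding is_min_int_poly_def by blast+
    with dvd show "f = g" by (rule associated_eqI)
  qed
qed

definition log_mahler_alg :: "complex \<Rightarrow> real" where
  "log_mahler_alg \<beta> = log_mahler (cpoly (min_int_poly \<beta>))"

definition is_factorization :: "complex \<Rightarrow> complex list \<Rightarrow> bool" where
  "is_factorization \<beta> \<beta>s \<longleftrightarrow>
     \<beta>s \<noteq> [] \<and> (\<forall>x\<in>set \<beta>s. algebraic x \<and> x \<noteq> 0) \<and> \<beta> = prod_list \<beta>s"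

definition mahler_lt :: "ereal \<Rightarrow> complex list \<Rightarrow> real" where
  "mahler_lt t \<beta>s =
     (if t = \<infinity> then Max (log_mahler_alg ` set \<beta>s)
      else (\<Sum>x\<leftarrow>\<beta>s. log_mahler_alg x powr real_of_ereal t) powr (1 / real_of_ereal t))"

text \<open>Intended for \<open>1 \<le> t \<le> \<infinity>\<close> and \<open>\<beta>\<close> algebraic and non-zero.\<close>

definition metric_mahler :: "ereal \<Rightarrow> complex \<Rightarrow> real" where
  "metric_mahler t \<beta> = Inf {mahler_lt t \<beta>s |\<beta>s. is_factorization \<beta> \<beta>s}"

definition attained_by :: "ereal \<Rightarrow> complex \<Rightarrow> complex list \<Rightarrow> bool" where
  "attained_by t \<beta> \<beta>s \<longleftrightarrow> is_factorization \<beta> \<beta>s \<and> metric_mahler t \<beta> = mahler_lt t \<beta>s"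

definition attained_in :: "ereal \<Rightarrow> complex \<Rightarrow> complex set \<Rightarrow> bool" where
  "attained_in t \<beta> S \<longleftrightarrow> (\<exists>\<beta>s. set \<beta>s \<subseteq> S \<and> attained_by t \<beta> \<beta>s)"

definition is_complex_subfield :: "complex set \<Rightarrow> bool" where
  "is_complex_subfield K \<longleftrightarrow> 0 \<in> K \<and> 1 \<in> K \<and>
     (\<forall>x\<in>K. \<forall>y\<in>K. x + y \<in> K \<and> x * y \<in> K) \<and> (\<forall>x\<in>K. - x \<in> K \<and> inverse x \<in> K)"

definition rat_adjoin :: "complex \<Rightarrow> complex set" where
  "rat_adjoin \<alpha> = \<Inter> {K. is_complex_subfield K \<and> \<alpha> \<in> K}"

end

theory Submission
  imports Defs "Jordan_Normal_Form.Char_Poly"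
begin

text \<open>
  In a factorization \<open>\<surd>D = \<beta>\<^sub>1 \<cdots> \<beta>\<^sub>N\<close> every prime \<open>p\<close> dividing \<open>D\<close> divides the constant coefficient
  \<open>c\<^sub>n\<close> of the minimal polynomial of some \<open>\<beta>\<^sub>n\<close>: otherwise the square of \<open>c\<^sub>1 \<cdots> c\<^sub>N / \<surd>D\<close>, a product
  of the algebraic integers \<open>c\<^sub>n / \<beta>\<^sub>n\<close>, would be rational with \<open>p\<close> in its denominator. As
  \<open>M(\<beta>\<^sub>n) \<ge> log \<bar>c\<^sub>n\<bar>\<close>, grouping the primes by the factor they are assigned to gives
  \<open>\<Sum> M(\<beta>\<^sub>n)\<^sup>t \<ge> \<Sum> (log p)\<^sup>t\<close>, with strict inequality if some \<open>M(\<beta>\<^sub>n)\<close> exceeds \<open>log p\<^sub>1\<close>. The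
  factors \<open>\<surd>p\<close> attain this bound for every \<open>D\<close>, and the points of the theorem do if \<open>D < p\<^sub>1\<^sup>2\<close>.

  Conversely, if the infimum is attained in \<open>\<rat>(\<surd>D)\<close>, then all \<open>M(\<beta>\<^sub>n) \<le> log p\<^sub>1\<close>. Since the norm
  of \<open>\<surd>D\<close> is \<open>-D\<close>, some \<open>\<beta>\<^sub>n\<close> has a norm with odd \<open>p\<^sub>1\<close>-adic valuation. It is irrational, and in
  its minimal polynomial \<open>f = aX\<^sup>2 + bX + c\<close> exactly one of \<open>\<bar>a\<bar>\<close>, \<open>\<bar>c\<bar>\<close> equals \<open>p\<^sub>1\<close>, while \<open>p\<^sub>1\<close>
  divides \<open>b\<close> because \<open>D\<close> divides the discriminant. If \<open>\<bar>c\<bar> = p\<^sub>1\<close>, equality in \<open>M(f) \<ge> log \<bar>c\<bar>\<close>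
  leaves \<open>f\<close> without roots in the open unit disc, so \<open>f(1)\<close> and \<open>f(-1)\<close> have the sign of \<open>f(0) =
  c\<close>, that is \<open>\<bar>b\<bar> \<le> \<bar>c\<bar> + sgn(c) a\<close>; the case \<open>\<bar>a\<bar> = p\<^sub>1\<close> is symmetric. Hence either \<open>ac > 0\<close>,
  \<open>\<bar>b\<bar> = p\<^sub>1\<close> and \<open>D \<le> b\<^sup>2 - 4ac < p\<^sub>1\<^sup>2\<close>, or \<open>ac < 0\<close>, \<open>b = 0\<close> and \<open>D \<le> \<bar>ac\<bar> < p\<^sub>1\<^sup>2\<close>.
\<close>

hide_const (open) module.smult
unbundle no fps_syntax

section \<open>Products of algebraic integers\<close>

interpretation int_module: Modules.module "\<lambda>(k::int) (z::'a::comm_ring_1). of_int k * z"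
  by unfold_locales (simp_all add: algebra_simps)

lemma int_span_mult:
  fixes x y :: "'a::comm_ring_1"
  assumes "x \<in> int_module.span S" "y \<in> int_module.span T"
  shows "x * y \<in> int_module.span {s * t | s t. s \<in> S \<and> t \<in> T}" (is "_ \<in> int_module.span ?ST")
proof -
  have base: "s * y \<in> int_module.span ?ST" if "s \<in> S" for s
    using assms(2)
  proof (induction rule: int_module.span_induct_alt)
    case (step c t z)
    have "s * t \<in> int_module.span ?ST" using that step by (intro int_module.span_base) blast
    then have "of_int c * (s * t) + s * z \<in> int_module.span ?ST"
      using step.IH by (intro int_module.span_add int_module.span_scale)
    then show ?case by (simp add: algebra_simps)
  qed (simp add: int_module.span_zero)
  show ?thesis
    using assms(1)
  proof (induction rule: int_module.span_induct_alt)
    case (step c s z)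
    then have "of_int c * (s * y) + z * y \<in> int_module.span ?ST"
      using base by (intro int_module.span_add int_module.span_scale)
    then show ?case by (simp add: algebra_simps)
  qed (simp add: int_module.span_zero)
qed

lemma algebraic_int_if_eigenvalue_of_int_mat:
  fixes x :: "'a::field_char_0"
  assumes "A \<in> carrier_mat n n" "eigenvalue (of_int_hom.mat_hom A) x"
  shows "algebraic_int x"
proof -
  have "poly (map_poly of_int (char_poly A)) x = 0"
    using assms by (simp add: eigenvalue_root_char_poly of_int_hom.char_poly_hom)
  then show ?thesis
    unfolding algebraic_int_altdef_ipoly using degree_monic_char_poly[OF assms(1)] by auto
qed

text \<open>Multiplication by \<open>x\<close> acts on the generators by an integer matrix with eigenvalue \<open>x\<close>.\<close>

lemma algebraic_int_if_stable_int_span: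
  fixes x :: "'a::field_char_0"
  assumes "finite S" "S \<noteq> {}" "0 \<notin> S"
    and stable: "\<And>s. s \<in> S \<Longrightarrow> x * s \<in> int_module.span S"
  shows "algebraic_int x"
proof -
  obtain ss where ss: "distinct ss" "set ss = S"
    using finite_distinct_list[OF \<open>finite S\<close>] by blast
  define n where "n = length ss"
  have "\<exists>u::'a \<Rightarrow> int. x * s = (\<Sum>t\<in>S. of_int (u t) * t)" if "s \<in> S" for s
    using stable[OF that] unfolding int_module.span_finite[OF \<open>finite S\<close>] by blast
  then obtain u :: "'a \<Rightarrow> 'a \<Rightarrow> int"
    where x_mult: "\<And>s. s \<in> S \<Longrightarrow> x * s = (\<Sum>t\<in>S. of_int (u s t) * t)"
    by metis
  define A where "A = mat n n (\<lambda>(i, j). u (ss ! i) (ss ! j))"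
  define v where "v = vec n ((!) ss)"
  have A_v: "of_int_hom.mat_hom A *\<^sub>v v = x \<cdot>\<^sub>v v"
  proof (rule eq_vecI)
    fix i assume "i < dim_vec (x \<cdot>\<^sub>v v)"
    then have "i < n" by (simp add: v_def)
    then have "(of_int_hom.mat_hom A *\<^sub>v v) $ i = (\<Sum>j<n. of_int (u (ss ! i) (ss ! j)) * ss ! j)"
      by (simp add: A_def v_def scalar_prod_def atLeast0LessThan)
    also have "\<dots> = (\<Sum>t\<in>S. of_int (u (ss ! i) t) * t)"
      using ss by (intro sum.reindex_bij_betw bij_betw_nth) (auto simp: n_def)
    also have "\<dots> = (x \<cdot>\<^sub>v v) $ i"
      using x_mult[of "ss ! i"] \<open>i < n\<close> ss by (auto simp: v_def n_def)
    finally show "(of_int_hom.mat_hom A *\<^sub>v v) $ i = (x \<cdot>\<^sub>v v) $ i" .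
  qed (simp add: A_def v_def)
  have "n > 0" using ss \<open>S \<noteq> {}\<close> by (auto simp: n_def)
  then have "v $ 0 \<noteq> 0" using ss \<open>0 \<notin> S\<close> by (auto simp: v_def n_def in_set_conv_nth)
  then have "v \<noteq> 0\<^sub>v n" using \<open>n > 0\<close> by auto
  moreover have "A \<in> carrier_mat n n" "v \<in> carrier_vec n" by (simp_all add: A_def v_def)
  ultimately have "eigenvalue (of_int_hom.mat_hom A) x"
    using A_v by (auto simp: eigenvalue_def eigenvector_def)
  with \<open>A \<in> carrier_mat n n\<close> show ?thesis by (rule algebraic_int_if_eigenvalue_of_int_mat)
qed

lemma algebraic_int_power_span:
  fixes x :: "'a::field_char_0"
  assumes "algebraic_int x"
  obtains n where "n > 0" "\<And>k. k < n \<Longrightarrow> x * x ^ k \<in> int_module.span ((^) x ` {..<n})"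
proof -
  obtain f :: "int poly" where root: "poly (map_poly of_int f) x = 0" and monic: "lead_coeff f = 1"
    using assms unfolding algebraic_int_altdef_ipoly by blast
  define n where "n = degree f"
  let ?M = "int_module.span ((^) x ` {..<n})"
  have "n > 0"
  proof (rule ccontr)
    assume "\<not> n > 0"
    then have "f = 1" using monic by (auto simp: n_def one_pCons elim!: degree_eq_zeroE)
    then show False using root by simp
  qed
  have "0 = (\<Sum>i\<le>n. of_int (coeff f i) * x ^ i)"
    using root by (simp add: poly_altdef n_def)
  also have "\<dots> = (\<Sum>i<n. of_int (coeff f i) * x ^ i) + x ^ n"
    using monic by (simp add: n_def flip: lessThan_Suc_atMost)
  finally have "x ^ n = (\<Sum>i<n. of_int (- coeff f i) * x ^ i)"
    by (simp add: sum_negf eq_neg_iff_add_eq_0 add.commute)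
  also have "\<dots> \<in> ?M"
    by (intro int_module.span_sum int_module.span_scale int_module.span_base) auto
  finally have top_power: "x ^ n \<in> ?M" .
  have "x * x ^ k \<in> ?M" if "k < n" for k
  proof (cases "Suc k = n")
    case False
    then show ?thesis using that by (intro int_module.span_base image_eqI[of _ _ "Suc k"]) auto
  qed (use top_power in auto)
  with \<open>n > 0\<close> show thesis using that by blast
qed

lemma algebraic_int_mult:
  fixes x y :: "'a::field_char_0"
  assumes "algebraic_int x" "algebraic_int y"
  shows "algebraic_int (x * y)"
proof (cases "x * y = 0")
  case False
  obtain m where "m > 0"
    and stable_x: "\<And>k. k < m \<Longrightarrow> x * x ^ k \<in> int_module.span ((^) x ` {..<m})"
    using algebraic_int_power_span[OF assms(1)] by blast
  obtain n where "n > 0"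
    and stable_y: "\<And>k. k < n \<Longrightarrow> y * y ^ k \<in> int_module.span ((^) y ` {..<n})"
    using algebraic_int_power_span[OF assms(2)] by blast
  let ?S = "{s * t | s t. s \<in> (^) x ` {..<m} \<and> t \<in> (^) y ` {..<n}}"
  show ?thesis
  proof (rule algebraic_int_if_stable_int_span)
    show "finite ?S" by (intro finite_image_set2) auto
    show "?S \<noteq> {}" using \<open>m > 0\<close> \<open>n > 0\<close> by auto
    show "0 \<notin> ?S" using False by auto
    fix z assume "z \<in> ?S"
    then obtain i j where "i < m" "j < n" and z_eq: "z = x ^ i * y ^ j" by blast
    then have "(x * x ^ i) * (y * y ^ j) \<in> int_module.span ?S"
      using stable_x stable_y by (intro int_span_mult)
    then show "x * y * z \<in> int_module.span ?S" by (simp add: z_eq mult_ac)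
  qed
qed auto

lemma algebraic_int_prod_list:
  fixes xs :: "'a::field_char_0 list"
  shows "(\<And>x. x \<in> set xs \<Longrightarrow> algebraic_int x) \<Longrightarrow> algebraic_int (prod_list xs)"
  by (induction xs) (auto intro: algebraic_int_mult)

lemma algebraic_int_lead_coeff_mult_root:
  fixes x :: "'a::field_char_0" and f :: "int poly"
  assumes root: "poly (map_poly of_int f) x = 0"
  shows "algebraic_int (of_int (lead_coeff f) * x)"
proof (cases "degree f = 0")
  case True
  then obtain c where "f = [:c:]" by (auto elim: degree_eq_zeroE)
  then show ?thesis using root by (simp add: Polynomial.map_poly_pCons)
next
  case False
  define a n where "a = lead_coeff f" and "n = degree f"
  define r where "r = (\<Sum>i<n. monom (coeff f i * a ^ (n - 1 - i)) i)"
  have "n > 0" using False by (simp add: n_def)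
  then have "degree r < n"
    unfolding r_def
    by (intro degree_sum_less) (auto intro: le_less_trans[OF degree_monom_le])
  then have monic: "lead_coeff (monom 1 n + r) = 1"
    by (simp add: degree_add_eq_left degree_monom_eq coeff_eq_0)
  have "poly (map_poly of_int (monom 1 n + r)) (of_int a * x) =
      (of_int a * x) ^ n + (\<Sum>i<n. of_int (coeff f i * a ^ (n - 1 - i)) * (of_int a * x) ^ i)"
    by (simp add: r_def hom_distribs poly_monom poly_sum)
  also have "(of_int a * x) ^ n = of_int a ^ (n - 1) * (of_int a * x ^ n)"
    using \<open>n > 0\<close> by (cases n) (simp_all add: power_mult_distrib)
  also have "(\<Sum>i<n. of_int (coeff f i * a ^ (n - 1 - i)) * (of_int a * x) ^ i) =
      of_int a ^ (n - 1) * (\<Sum>i<n. of_int (coeff f i) * x ^ i)"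
    unfolding sum_distrib_left
  proof (rule sum.cong)
    fix i assume "i \<in> {..<n}"
    then have "of_int a ^ (n - 1) = (of_int a ^ (n - 1 - i) * of_int a ^ i :: 'a)"
      by (simp flip: power_add)
    then show "of_int (coeff f i * a ^ (n - 1 - i)) * (of_int a * x) ^ i =
        of_int a ^ (n - 1) * (of_int (coeff f i) * x ^ i)"
      by (simp add: power_mult_distrib)
  qed simp
  also have "of_int a ^ (n - 1) * (of_int a * x ^ n) + \<dots> =
      of_int a ^ (n - 1) * poly (map_poly of_int f) x"
    by (simp add: poly_altdef n_def a_def algebra_simps flip: lessThan_Suc_atMost)
  finally show ?thesis
    unfolding algebraic_int_altdef_ipoly using root monic a_def by auto
qed

lemma algebraic_int_const_coeff_div_root:
  fixes x :: "'a::field_char_0" and f :: "int poly"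
  assumes root: "poly (map_poly of_int f) x = 0" and "x \<noteq> 0"
  shows "algebraic_int (of_int (coeff f 0) / x)"
proof (cases "coeff f 0 = 0")
  case False
  then have "lead_coeff (reflect_poly f) = coeff f 0"
    by (simp add: coeff_reflect_poly)
  moreover have "map_poly of_int (reflect_poly f) = reflect_poly (map_poly of_int f :: 'a poly)"
    by (rule poly_eqI) (simp add: coeff_map_poly coeff_reflect_poly)
  then have "poly (map_poly of_int (reflect_poly f)) (inverse x) = 0"
    using root \<open>x \<noteq> 0\<close> by (simp add: poly_reflect_poly_nz)
  ultimately show ?thesis
    using algebraic_int_lead_coeff_mult_root by (metis divide_inverse)
qed simp

lemma prime_dvd_const_coeff_if_prod_list_square:
  fixes \<beta>s :: "'a::field_char_0 list" and f :: "'a \<Rightarrow> int poly" and p d :: int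
  assumes "prime p" "p dvd d" "d \<noteq> 0" and square: "(prod_list \<beta>s)\<^sup>2 = of_int d"
    and root: "\<And>\<beta>. \<beta> \<in> set \<beta>s \<Longrightarrow> poly (map_poly of_int (f \<beta>)) \<beta> = 0"
  shows "\<exists>\<beta>\<in>set \<beta>s. p dvd coeff (f \<beta>) 0"
proof -
  define m where "m = (\<Prod>\<beta>\<leftarrow>\<beta>s. coeff (f \<beta>) 0)"
  have "prod_list \<beta>s \<noteq> 0" using square \<open>d \<noteq> 0\<close> by (metis of_int_eq_0_iff zero_power2)
  then have "0 \<notin> set \<beta>s" by (simp add: prod_list_zero_iff)
  then have "algebraic_int (\<Prod>\<beta>\<leftarrow>\<beta>s. of_int (coeff (f \<beta>) 0) / \<beta>)"
    using root by (intro algebraic_int_prod_list) (auto intro!: algebraic_int_const_coeff_div_root)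
  also have "(\<Prod>\<beta>\<leftarrow>\<beta>s. of_int (coeff (f \<beta>) 0) / \<beta>) = of_int m / prod_list \<beta>s"
    unfolding m_def by (induction \<beta>s) auto
  finally have "algebraic_int ((of_int m / prod_list \<beta>s) * (of_int m / prod_list \<beta>s))"
    by (intro algebraic_int_mult)
  moreover have "(of_int m / prod_list \<beta>s) * (of_int m / prod_list \<beta>s) = of_int (m\<^sup>2) / of_int d"
    using square by (simp add: power2_eq_square)
  ultimately have "of_int (m\<^sup>2) / of_int d \<in> (\<int> :: 'a set)"
    by (intro rational_algebraic_int_is_int) auto
  then obtain k where "of_int (m\<^sup>2) / of_int d = (of_int k :: 'a)" by (elim Ints_cases)
  then have "of_int (m\<^sup>2) = (of_int (k * d) :: 'a)" using \<open>d \<noteq> 0\<close> by (simp add: field_simps)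
  then have "p dvd m\<^sup>2" using \<open>p dvd d\<close> by (simp only: of_int_eq_iff dvd_mult)
  then have "p dvd m" using \<open>prime p\<close> by (rule prime_dvd_power[rotated])
  then show ?thesis
    unfolding m_def using \<open>prime p\<close>
    by (induction \<beta>s) (auto simp: prime_dvd_mult_iff)
qed

section \<open>Mahler measures of polynomials and algebraic numbers\<close>

lemma is_min_int_poly_min_int_poly: "algebraic \<beta> \<Longrightarrow> is_min_int_poly \<beta> (min_int_poly \<beta>)"
  unfolding min_int_poly_def by (rule theI') (rule ex1_is_min_int_poly)

lemma min_int_poly_eqI: "algebraic \<beta> \<Longrightarrow> is_min_int_poly \<beta> f \<Longrightarrow> min_int_poly \<beta> = f"
  using ex1_is_min_int_poly is_min_int_poly_min_int_poly by blast

lemma min_int_poly_root: "algebraic \<beta> \<Longrightarrow> poly (cpoly (min_int_poly \<beta>)) \<beta> = 0"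
  and min_int_poly_nonzero: "algebraic \<beta> \<Longrightarrow> min_int_poly \<beta> \<noteq> 0"
  using is_min_int_poly_min_int_poly by (auto simp: is_min_int_poly_def)

lemma algebraic_if_root: "f \<noteq> 0 \<Longrightarrow> poly (cpoly f) \<beta> = 0 \<Longrightarrow> algebraic \<beta>"
  by (rule algebraicI[of "cpoly f"]) (auto simp: coeff_map_poly of_int_poly_hom.hom_0_iff)

lemma min_int_poly_dvd:
  assumes "f \<noteq> 0" "poly (cpoly f) \<beta> = 0"
  shows "min_int_poly \<beta> dvd f"
proof -
  obtain h where "irreducible h" "h dvd f" "poly (cpoly h) \<beta> = 0"
    using ex_irreducible_root_factor[OF assms] by blast
  moreover have "irreducible (- h)"
    using \<open>irreducible h\<close> irreducible_mult_unit_left[of "- 1" h] by simp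
  ultimately have "is_min_int_poly \<beta> h \<or> is_min_int_poly \<beta> (- h)"
    by (auto simp: is_min_int_poly_def of_int_poly_hom.hom_uminus simp flip: leading_coeff_0_iff)
  then show ?thesis
    using min_int_poly_eqI[OF algebraic_if_root[OF assms]] \<open>h dvd f\<close> by auto
qed

lemma coeff_0_min_int_poly_nonzero:
  assumes "algebraic \<beta>" "\<beta> \<noteq> 0"
  shows "coeff (min_int_poly \<beta>) 0 \<noteq> 0"
proof
  assume "coeff (min_int_poly \<beta>) 0 = 0"
  then obtain g where factor: "min_int_poly \<beta> = pCons 0 g" by (cases "min_int_poly \<beta>") auto
  have "g \<noteq> 0" using min_int_poly_nonzero[OF assms(1)] factor by auto
  moreover have "poly (cpoly g) \<beta> = 0"
    using min_int_poly_root[OF assms(1)] assms(2)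
    by (simp add: factor Polynomial.map_poly_pCons)
  ultimately have "min_int_poly \<beta> dvd g" by (rule min_int_poly_dvd)
  then have "degree (min_int_poly \<beta>) \<le> degree g" using \<open>g \<noteq> 0\<close> by (rule dvd_imp_degree_le)
  then show False using factor \<open>g \<noteq> 0\<close> by simp
qed

lemma log_mahler_mult:
  assumes "f \<noteq> 0" "g \<noteq> 0"
  shows "log_mahler (f * g) = log_mahler f + log_mahler g"
  using assms by (simp add: log_mahler_def proots_mult lead_coeff_mult norm_mult ln_mult)

lemma sum_mset_nonneg:
  fixes f :: "'a \<Rightarrow> real"
  shows "(\<And>x. x \<in># A \<Longrightarrow> 0 \<le> f x) \<Longrightarrow> 0 \<le> (\<Sum>x\<in>#A. f x)"
  by (induction A) auto

lemma member_le_sum_mset: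
  fixes f :: "'a \<Rightarrow> real"
  assumes "x \<in># A" "\<And>y. y \<in># A \<Longrightarrow> 0 \<le> f y"
  shows "f x \<le> (\<Sum>y\<in>#A. f y)"
proof -
  obtain B where "A = add_mset x B" using assms(1) by (rule mset_add)
  then show ?thesis using assms(2) by (simp add: sum_mset_nonneg)
qed

lemma ln_lead_coeff_le_log_mahler: "ln (cmod (lead_coeff f)) \<le> log_mahler f"
  by (simp add: log_mahler_def sum_mset_nonneg)

lemma norm_root_le_1_if_log_mahler_le:
  assumes "f \<noteq> 0" "log_mahler f \<le> ln (cmod (lead_coeff f))" "poly f x = 0"
  shows "cmod x \<le> 1"
proof -
  have "max 0 (ln (cmod x)) \<le> (\<Sum>y\<in>#proots f. max 0 (ln (cmod y)))"
    using assms(1,3) by (intro member_le_sum_mset) auto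
  then have "ln (cmod x) \<le> 0" using assms(2) by (simp add: log_mahler_def)
  then show ?thesis by (cases "x = 0") auto
qed

text \<open>Jensen's formula, evaluated from the constant instead of the leading coefficient.\<close>

lemma log_mahler_eq_coeff_0:
  assumes "coeff f 0 \<noteq> 0"
  shows "log_mahler f = ln (cmod (coeff f 0)) + (\<Sum>x\<in>#proots f. max 0 (- ln (cmod x)))"
proof -
  have "f \<noteq> 0" using assms by auto
  then have "0 \<notin># proots f" using assms by (simp add: poly_0_coeff_0)
  moreover have "(\<Prod>x\<in>#A. - x) \<noteq> 0 \<and>
      ln (cmod (\<Prod>x\<in>#A. - x)) =
        (\<Sum>x\<in>#A. max 0 (ln (cmod x))) - (\<Sum>x\<in>#A. max 0 (- ln (cmod x)))"
    if "0 \<notin># A" for A :: "complex multiset"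
    using that by (induction A) (auto simp: norm_mult ln_mult)
  ultimately have root_prod: "(\<Prod>x\<in>#proots f. - x) \<noteq> 0"
      "ln (cmod (\<Prod>x\<in>#proots f. - x)) =
        (\<Sum>x\<in>#proots f. max 0 (ln (cmod x))) - (\<Sum>x\<in>#proots f. max 0 (- ln (cmod x)))"
    by blast+
  have "coeff f 0 = poly (smult (lead_coeff f) (\<Prod>x\<in>#proots f. [:- x, 1:])) 0"
    unfolding complex_poly_decompose_multiset by (rule poly_0_coeff_0[symmetric])
  also have "\<dots> = lead_coeff f * (\<Prod>x\<in>#proots f. - x)"
    by (simp add: poly_prod_mset image_mset.compositionality o_def)
  finally have "ln (cmod (coeff f 0)) = ln (cmod (lead_coeff f)) + ln (cmod (\<Prod>x\<in>#proots f. - x))"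
    using \<open>f \<noteq> 0\<close> root_prod(1) by (simp add: norm_mult ln_mult)
  then show ?thesis using root_prod(2) by (simp add: log_mahler_def)
qed

lemma ln_coeff_0_le_log_mahler: "coeff f 0 \<noteq> 0 \<Longrightarrow> ln (cmod (coeff f 0)) \<le> log_mahler f"
  by (simp add: log_mahler_eq_coeff_0 sum_mset_nonneg)

lemma norm_root_ge_1_if_log_mahler_le:
  assumes "coeff f 0 \<noteq> 0" "log_mahler f \<le> ln (cmod (coeff f 0))" "poly f x = 0"
  shows "1 \<le> cmod x"
proof -
  have "f \<noteq> 0" "x \<noteq> 0" using assms(1,3) by (auto simp: poly_0_coeff_0)
  then have "max 0 (- ln (cmod x)) \<le> (\<Sum>y\<in>#proots f. max 0 (- ln (cmod y)))"
    using assms(3) by (intro member_le_sum_mset) auto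
  then have "0 \<le> ln (cmod x)" using assms(1,2) by (simp add: log_mahler_eq_coeff_0)
  then show ?thesis using \<open>x \<noteq> 0\<close> by simp
qed

lemma log_mahler_cpoly_nonneg:
  assumes "f \<noteq> 0"
  shows "0 \<le> log_mahler (cpoly f)"
proof -
  have "1 \<le> \<bar>lead_coeff f\<bar>" using assms leading_coeff_0_iff[of f] by linarith
  then have "1 \<le> cmod (lead_coeff (cpoly f))" by simp
  then have "0 \<le> ln (cmod (lead_coeff (cpoly f)))" by (rule ln_ge_zero)
  also have "\<dots> \<le> log_mahler (cpoly f)" by (rule ln_lead_coeff_le_log_mahler)
  finally show ?thesis .
qed

lemma log_mahler_alg_nonneg: "algebraic \<beta> \<Longrightarrow> 0 \<le> log_mahler_alg \<beta>"
  unfolding log_mahler_alg_def by (intro log_mahler_cpoly_nonneg min_int_poly_nonzero)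

lemma log_mahler_alg_le:
  assumes "f \<noteq> 0" "poly (cpoly f) \<beta> = 0"
  shows "log_mahler_alg \<beta> \<le> log_mahler (cpoly f)"
proof -
  obtain h where factor: "f = min_int_poly \<beta> * h" using min_int_poly_dvd[OF assms] by (elim dvdE)
  then have "min_int_poly \<beta> \<noteq> 0" "h \<noteq> 0" using \<open>f \<noteq> 0\<close> by auto
  then show ?thesis
    using log_mahler_cpoly_nonneg[of h]
    by (simp add: factor cpoly_mult log_mahler_mult of_int_poly_hom.hom_0_iff log_mahler_alg_def)
qed

lemma log_mahler_alg_of_nat_le:
  assumes "n > 0"
  shows "log_mahler_alg (of_nat n) \<le> ln (real n)"
proof -
  define f :: "int poly" where "f = [:- int n, 1:]"
  have "f \<noteq> 0" and cpoly_f: "cpoly f = [:- of_nat n, 1:]"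
    by (simp_all add: f_def Polynomial.map_poly_pCons)
  have "log_mahler (cpoly f) = ln (real n)"
    using assms by (simp add: cpoly_f log_mahler_def)
  then show ?thesis using log_mahler_alg_le[of f "of_nat n"] \<open>f \<noteq> 0\<close> by (simp add: cpoly_f)
qed

lemma
  assumes "m > 0" "n > 0" and square: "of_nat n * \<alpha>\<^sup>2 = (of_nat m :: complex)"
  shows algebraic_square_root_quotient: "algebraic \<alpha>"
    and log_mahler_alg_square_root_quotient_le:
      "log_mahler_alg \<alpha> \<le> max (ln (real m)) (ln (real n))"
proof -
  define f :: "int poly" where "f = [:- int m, 0, int n:]"
  have "f \<noteq> 0" using assms by (simp add: f_def)
  have root: "poly (cpoly f) \<alpha> = 0"
    using square by (simp add: f_def Polynomial.map_poly_pCons power2_eq_square algebra_simps)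
  then show "algebraic \<alpha>" using \<open>f \<noteq> 0\<close> by (intro algebraic_if_root)
  have factors: "cpoly f = smult (of_nat n) ([:- \<alpha>, 1:] * [:\<alpha>, 1:])"
    using square by (simp add: f_def Polynomial.map_poly_pCons power2_eq_square)
  have "proots (cpoly f) = {#\<alpha>, - \<alpha>#}"
    unfolding factors using \<open>n > 0\<close> by (subst proots_smult, simp, subst proots_mult) auto
  then have log_mahler: "log_mahler (cpoly f) = ln (real n) + 2 * max 0 (ln (cmod \<alpha>))"
    using \<open>n > 0\<close> by (simp add: log_mahler_def f_def)
  have "real n * (cmod \<alpha>)\<^sup>2 = real m"
    using arg_cong[OF square, of cmod] by (simp add: norm_mult norm_power)
  moreover from this have "cmod \<alpha> > 0" using \<open>m > 0\<close> by auto
  ultimately have "ln (real m) = ln (real n) + 2 * ln (cmod \<alpha>)"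
    using \<open>n > 0\<close> by (simp add: ln_mult ln_realpow flip: \<open>real n * (cmod \<alpha>)\<^sup>2 = real m\<close>)
  then show "log_mahler_alg \<alpha> \<le> max (ln (real m)) (ln (real n))"
    using log_mahler_alg_le[OF \<open>f \<noteq> 0\<close> root] log_mahler by linarith
qed

lemma ln_le_log_mahler_alg_if_dvd_const_coeff:
  assumes \<beta>: "algebraic \<beta>" "\<beta> \<noteq> 0"
    and "n > 0" "int n dvd coeff (min_int_poly \<beta>) 0"
  shows "ln (real n) \<le> log_mahler_alg \<beta>"
proof -
  define c where "c = coeff (min_int_poly \<beta>) 0"
  have "c \<noteq> 0" "int n dvd c"
    using coeff_0_min_int_poly_nonzero[OF \<beta>] assms(4) by (simp_all add: c_def)
  then have "int n \<le> \<bar>c\<bar>" by (intro zdvd_imp_le) auto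
  then have "real n \<le> cmod (coeff (cpoly (min_int_poly \<beta>)) 0)"
    by (simp add: coeff_map_poly c_def)
  then have "ln (real n) \<le> ln (cmod (coeff (cpoly (min_int_poly \<beta>)) 0))"
    using \<open>n > 0\<close> by (intro ln_mono) auto
  also have "\<dots> \<le> log_mahler_alg \<beta>"
    unfolding log_mahler_alg_def
    using \<open>c \<noteq> 0\<close> by (intro ln_coeff_0_le_log_mahler) (simp add: coeff_map_poly c_def)
  finally show ?thesis .
qed

section \<open>Norms of grouped families\<close>

definition lp_norm :: "ereal \<Rightarrow> ('a \<Rightarrow> real) \<Rightarrow> 'a set \<Rightarrow> real" where
  "lp_norm t x I =
     (if t = \<infinity> then Max (x ` I)
      else (\<Sum>i\<in>I. x i powr real_of_ereal t) powr (1 / real_of_ereal t))"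

lemma sum_powr_le_sum_mult_powr:
  fixes x :: "'a \<Rightarrow> real"
  assumes "\<And>i. i \<in> S \<Longrightarrow> 0 \<le> x i \<and> x i \<le> P" "t \<ge> 1"
  shows "(\<Sum>i\<in>S. x i powr t) \<le> sum x S * P powr (t - 1)"
  unfolding sum_distrib_right
proof (rule sum_mono)
  fix i assume "i \<in> S"
  have "x i powr t = x i * x i powr (t - 1)"
    using powr_mult_base[of "x i" "t - 1"] assms(1)[OF \<open>i \<in> S\<close>] by simp
  also have "\<dots> \<le> x i * P powr (t - 1)"
    using assms(1)[OF \<open>i \<in> S\<close>] \<open>t \<ge> 1\<close> by (intro mult_left_mono powr_mono2) auto
  finally show "x i powr t \<le> x i * P powr (t - 1)" .
qed

lemma sum_powr_le_powr:
  fixes x :: "'a \<Rightarrow> real"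
  assumes "finite S" "\<And>i. i \<in> S \<Longrightarrow> 0 \<le> x i" "sum x S \<le> M" "t \<ge> 1"
  shows "(\<Sum>i\<in>S. x i powr t) \<le> M powr t"
proof -
  have "x i \<le> M" if "i \<in> S" for i
    using member_le_sum[OF that, of x] assms(1-3) by fastforce
  then have "(\<Sum>i\<in>S. x i powr t) \<le> sum x S * M powr (t - 1)"
    using assms by (intro sum_powr_le_sum_mult_powr) auto
  also have "\<dots> \<le> M * M powr (t - 1)"
    using assms(3) by (intro mult_right_mono) auto
  also have "\<dots> = M powr t"
    using powr_mult_base[of M "t - 1"] sum_nonneg[of S x] assms(2,3) by simp
  finally show ?thesis .
qed

lemma sum_powr_less_powr:
  fixes x :: "'a \<Rightarrow> real"
  assumes "\<And>i. i \<in> S \<Longrightarrow> 0 \<le> x i \<and> x i \<le> P" "0 \<le> P" "P < M" "sum x S \<le> M" "t > 1"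
  shows "(\<Sum>i\<in>S. x i powr t) < M powr t"
proof -
  have "(\<Sum>i\<in>S. x i powr t) \<le> sum x S * P powr (t - 1)"
    using assms by (intro sum_powr_le_sum_mult_powr) auto
  also have "\<dots> \<le> M * P powr (t - 1)"
    using assms(4) by (intro mult_right_mono) auto
  also have "\<dots> < M * M powr (t - 1)"
    using assms by (intro mult_strict_left_mono powr_less_mono2) auto
  also have "\<dots> = M powr t" using powr_mult_base[of M "t - 1"] assms(2,3) by simp
  finally show ?thesis .
qed

context
  fixes I :: "'i set" and J :: "'j set" and x :: "'i \<Rightarrow> real" and y :: "'j \<Rightarrow> real" and n :: "'i \<Rightarrow> 'j"
  assumes finite_I: "finite I" and I_nonempty: "I \<noteq> {}" and finite_J: "finite J"
    and group_mem: "\<And>i. i \<in> I \<Longrightarrow> n i \<in> J"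
    and x_nonneg: "\<And>i. i \<in> I \<Longrightarrow> 0 \<le> x i"
    and group_sum_le: "\<And>j. j \<in> J \<Longrightarrow> (\<Sum>i | i \<in> I \<and> n i = j. x i) \<le> y j"
begin

lemma sum_grouped: "(\<Sum>i\<in>I. f i) = (\<Sum>j\<in>J. \<Sum>i | i \<in> I \<and> n i = j. f i)" for f :: "'i \<Rightarrow> real"
  using finite_I finite_J group_mem by (intro sum.group[symmetric]) auto

lemma group_sum_powr_le:
  "j \<in> J \<Longrightarrow> t \<ge> 1 \<Longrightarrow> (\<Sum>i | i \<in> I \<and> n i = j. x i powr t) \<le> y j powr t"
  using finite_I x_nonneg group_sum_le by (intro sum_powr_le_powr) auto

lemma sum_powr_le_if_grouped: "t \<ge> 1 \<Longrightarrow> (\<Sum>i\<in>I. x i powr t) \<le> (\<Sum>j\<in>J. y j powr t)"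
  unfolding sum_grouped by (intro sum_mono group_sum_powr_le)

lemma sum_powr_less_if_grouped:
  assumes "\<And>i. i \<in> I \<Longrightarrow> x i \<le> P" "k \<in> J" "P < y k" "t > 1"
  shows "(\<Sum>i\<in>I. x i powr t) < (\<Sum>j\<in>J. y j powr t)"
  unfolding sum_grouped
proof (rule sum_strict_mono_ex1)
  have "0 \<le> P" using I_nonempty x_nonneg assms(1) by force
  then have "(\<Sum>i | i \<in> I \<and> n i = k. x i powr t) < y k powr t"
    using assms x_nonneg group_sum_le by (intro sum_powr_less_powr[where P = P]) auto
  then show "\<exists>j\<in>J. (\<Sum>i | i \<in> I \<and> n i = j. x i powr t) < y j powr t"
    using \<open>k \<in> J\<close> by blast
qed (use finite_J group_sum_powr_le \<open>t > 1\<close> in auto)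

lemma le_group_bound: "i \<in> I \<Longrightarrow> x i \<le> y (n i)"
  using group_sum_le[OF group_mem] finite_I x_nonneg
    member_le_sum[of i "{k \<in> I. n k = n i}" x] by fastforce

lemma lp_norm_le_if_grouped:
  assumes "t \<ge> 1"
  shows "lp_norm t x I \<le> lp_norm t y J"
proof (cases t)
  case (real r)
  then show ?thesis
    using sum_powr_le_if_grouped[of r] assms
    by (auto simp: lp_norm_def intro!: powr_mono2 sum_nonneg)
next
  case PInf
  have "Max (x ` I) \<le> Max (y ` J)"
  proof (rule Max.boundedI)
    fix a assume "a \<in> x ` I"
    then obtain i where "i \<in> I" "a = x i" by blast
    then have "a \<le> y (n i)" using le_group_bound by simp
    also have "\<dots> \<le> Max (y ` J)" using finite_J group_mem \<open>i \<in> I\<close> by (intro Max_ge) auto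
    finally show "a \<le> Max (y ` J)" .
  qed (use finite_I I_nonempty in auto)
  then show ?thesis using PInf by (simp add: lp_norm_def)
qed (use assms in auto)

lemma le_if_lp_norm_le_if_grouped:
  assumes "t > 1" "lp_norm t y J \<le> lp_norm t x I" "k \<in> J" and bound: "\<And>i. i \<in> I \<Longrightarrow> x i \<le> P"
  shows "y k \<le> P"
proof (cases t)
  case (real r)
  show ?thesis
  proof (rule ccontr)
    assume "\<not> y k \<le> P"
    then have "(\<Sum>i\<in>I. x i powr r) < (\<Sum>j\<in>J. y j powr r)"
      using bound \<open>k \<in> J\<close> \<open>t > 1\<close> real by (intro sum_powr_less_if_grouped[where P = P]) auto
    then have "lp_norm t x I < lp_norm t y J"
      using real \<open>t > 1\<close> by (auto simp: lp_norm_def intro!: powr_less_mono2 sum_nonneg)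
    then show False using assms(2) by simp
  qed
next
  case PInf
  have "y k \<le> Max (y ` J)" using finite_J \<open>k \<in> J\<close> by (intro Max_ge) auto
  also have "\<dots> \<le> Max (x ` I)" using assms(2) PInf by (simp add: lp_norm_def)
  also have "\<dots> \<le> P" using finite_I I_nonempty bound by (intro Max.boundedI) auto
  finally show ?thesis .
qed (use assms in auto)

end

lemma lp_norm_mono:
  assumes "finite I" "I \<noteq> {}" "t \<ge> 1" "\<And>i. i \<in> I \<Longrightarrow> 0 \<le> x i \<and> x i \<le> y i"
  shows "lp_norm t x I \<le> lp_norm t y I"
proof (rule lp_norm_le_if_grouped[where n = "\<lambda>i. i"])
  fix j assume "j \<in> I"
  then have "{i. i \<in> I \<and> i = j} = {j}" by auto
  then show "(\<Sum>i | i \<in> I \<and> i = j. x i) \<le> y j" using assms(4) \<open>j \<in> I\<close> by simp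
qed (use assms in auto)

lemma mahler_lt_eq_lp_norm:
  "mahler_lt t \<beta>s = lp_norm t (\<lambda>k. log_mahler_alg (\<beta>s ! k)) {..<length \<beta>s}"
proof -
  have "set \<beta>s = (!) \<beta>s ` {..<length \<beta>s}" by (auto simp: set_conv_nth)
  then show ?thesis
    by (simp add: mahler_lt_def lp_norm_def sum_list_sum_nth atLeast0LessThan image_image)
qed

lemma mahler_lt_map_eq_lp_norm:
  "distinct ks \<Longrightarrow> mahler_lt t (map h ks) = lp_norm t (\<lambda>i. log_mahler_alg (h i)) (set ks)"
  by (simp add: mahler_lt_def lp_norm_def sum_list_distinct_conv_sum_set image_image o_def)

section \<open>Integer quadratic polynomials of small Mahler measure\<close>

lemma poly_cpoly_of_real: "poly (cpoly f) (of_real x) = of_real (poly (map_poly of_int f) x)"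
  by (induction f) (simp_all add: Polynomial.map_poly_pCons)

lemma abs_middle_coeff_le_if_no_root_in_unit_interval:
  fixes a b c :: int
  assumes no_root: "\<And>x::real. \<bar>x\<bar> < 1 \<Longrightarrow> poly (map_poly of_int [:c, b, a:]) x \<noteq> 0"
  shows "\<bar>b\<bar> * \<bar>c\<bar> \<le> c * (c + a)"
proof -
  let ?f = "map_poly real_of_int [:c, b, a:]"
  have "0 \<le> poly ?f 0 * poly ?f 1"
    using poly_IVT[of 0 1 ?f] no_root by fastforce
  moreover have "0 \<le> poly ?f (- 1) * poly ?f 0"
    using poly_IVT[of "- 1" 0 ?f] no_root by fastforce
  ultimately have "\<bar>real_of_int b\<bar> * \<bar>real_of_int c\<bar> \<le> of_int c * (of_int c + of_int a)"
    by (simp add: Polynomial.map_poly_pCons abs_le_iff algebra_simps flip: abs_mult)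
  then show ?thesis by (simp flip: of_int_abs of_int_mult of_int_add)
qed

lemma less_square_if_dvd_discriminant:
  fixes a b c d P :: int
  assumes abs_c: "\<bar>c\<bar> = P" and "a \<noteq> 0" "\<bar>a\<bar> < P"
    and middle: "\<bar>b\<bar> * \<bar>c\<bar> \<le> c * (c + a)" and "P dvd b"
    and disc: "d dvd b\<^sup>2 - 4 * a * c" "0 < b\<^sup>2 - 4 * a * c" and "b = 0 \<Longrightarrow> d dvd a * c"
  shows "d < P\<^sup>2"
proof -
  have "P > 0" and "c \<noteq> 0" using assms(1-3) by auto
  have ac_less: "\<bar>a * c\<bar> < P * P"
    using \<open>P > 0\<close> assms(1-3) by (simp add: abs_mult)
  obtain k where b_eq: "b = P * k" using \<open>P dvd b\<close> by (elim dvdE)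
  have "P * (P * \<bar>k\<bar>) = \<bar>b\<bar> * \<bar>c\<bar>" using abs_c \<open>P > 0\<close> by (simp add: b_eq abs_mult)
  also have "\<dots> \<le> P * P + a * c"
    using middle abs_mult_self_eq[of c] unfolding abs_c by (simp add: algebra_simps)
  finally have k_bound: "P * (P * \<bar>k\<bar>) \<le> P * P + a * c" .
  consider (pos) "a * c > 0" | (neg) "a * c < 0"
    using \<open>a \<noteq> 0\<close> \<open>c \<noteq> 0\<close> by (metis linorder_neqE mult_eq_0_iff)
  then show ?thesis
  proof cases
    case pos
    then have "P * (P * \<bar>k\<bar>) < P * (P * 2)" using k_bound ac_less by simp
    then have "\<bar>k\<bar> < 2" using \<open>P > 0\<close> by simp
    moreover have "k \<noteq> 0" using disc(2) pos b_eq by auto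
    ultimately have "\<bar>k\<bar> = 1" by linarith
    then have "b\<^sup>2 = P\<^sup>2" by (metis b_eq abs_mult mult.right_neutral power2_abs)
    moreover have "d \<le> b\<^sup>2 - 4 * a * c" using disc by (rule zdvd_imp_le)
    ultimately show ?thesis using pos by simp
  next
    case neg
    then have "P * (P * \<bar>k\<bar>) < P * (P * 1)" using k_bound by simp
    then have "\<bar>k\<bar> < 1" using \<open>P > 0\<close> by simp
    then have "d dvd \<bar>a * c\<bar>" using assms(8) b_eq by simp
    then have "d \<le> \<bar>a * c\<bar>" using neg by (intro zdvd_imp_le) auto
    then show ?thesis using ac_less by (simp add: power2_eq_square)
  qed
qed

lemma abs_middle_coeff_le_if_log_mahler_le_const_coeff:
  fixes a b c :: int
  assumes "c \<noteq> 0" "log_mahler (cpoly [:c, b, a:]) \<le> ln \<bar>real_of_int c\<bar>"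
  shows "\<bar>b\<bar> * \<bar>c\<bar> \<le> c * (c + a)"
proof (rule abs_middle_coeff_le_if_no_root_in_unit_interval, rule notI)
  fix x :: real
  assume "\<bar>x\<bar> < 1" and root: "poly (map_poly of_int [:c, b, a:]) x = 0"
  have "1 \<le> cmod (of_real x)"
  proof (rule norm_root_ge_1_if_log_mahler_le)
    show "poly (cpoly [:c, b, a:]) (of_real x) = 0" unfolding poly_cpoly_of_real root by simp
  qed (use assms in \<open>auto simp: coeff_map_poly\<close>)
  then show False using \<open>\<bar>x\<bar> < 1\<close> by simp
qed

lemma abs_middle_coeff_le_if_log_mahler_le_lead_coeff:
  fixes a b c :: int
  assumes "a \<noteq> 0" "log_mahler (cpoly [:c, b, a:]) \<le> ln \<bar>real_of_int a\<bar>"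
  shows "\<bar>b\<bar> * \<bar>a\<bar> \<le> a * (a + c)"
proof (rule abs_middle_coeff_le_if_no_root_in_unit_interval, rule notI)
  fix x :: real
  assume "\<bar>x\<bar> < 1" and root: "poly (map_poly of_int [:a, b, c:]) x = 0"
  then have "x \<noteq> 0" using \<open>a \<noteq> 0\<close> by (auto simp: Polynomial.map_poly_pCons)
  then have "poly (map_poly of_int [:c, b, a:]) (1 / x) = 0"
    using root by (simp add: Polynomial.map_poly_pCons field_simps)
  then have "poly (cpoly [:c, b, a:]) (of_real (1 / x)) = 0"
    by (simp only: poly_cpoly_of_real of_real_0)
  then have "cmod (of_real (1 / x)) \<le> 1"
    by (rule norm_root_le_1_if_log_mahler_le[rotated 2])
      (use assms in \<open>auto simp del: map_poly_pCons\<close>)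
  then show False using \<open>x \<noteq> 0\<close> \<open>\<bar>x\<bar> < 1\<close> by (simp only: norm_of_real) (simp add: field_simps)
qed

lemma abs_outer_coeffs_le_if_log_mahler_le:
  fixes a b c P :: int
  assumes "log_mahler (cpoly [:c, b, a:]) \<le> ln (real_of_int P)" "a \<noteq> 0" "c \<noteq> 0" "P > 0"
  shows "\<bar>a\<bar> \<le> P" and "\<bar>c\<bar> \<le> P"
proof -
  have "ln \<bar>real_of_int a\<bar> \<le> ln (real_of_int P)"
    using order_trans[OF ln_lead_coeff_le_log_mahler assms(1)] \<open>a \<noteq> 0\<close> by simp
  then show "\<bar>a\<bar> \<le> P" using assms by (simp flip: of_int_abs)
  have "ln \<bar>real_of_int c\<bar> \<le> ln (real_of_int P)"
    using order_trans[OF ln_coeff_0_le_log_mahler assms(1)] \<open>c \<noteq> 0\<close>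
    by (simp add: coeff_map_poly)
  then show "\<bar>c\<bar> \<le> P" using assms by (simp flip: of_int_abs)
qed

lemma odd_multiplicity_mult_cases:
  fixes a c P :: int
  assumes "prime P" "odd (multiplicity P (a * c))" "\<bar>a\<bar> \<le> P" "\<bar>c\<bar> \<le> P" "a \<noteq> 0" "c \<noteq> 0"
  obtains (lead) "\<bar>a\<bar> = P" "\<bar>c\<bar> < P" | (const) "\<bar>c\<bar> = P" "\<bar>a\<bar> < P"
proof -
  have "P dvd a * c" using assms(2) not_dvd_imp_multiplicity_0 by fastforce
  then have "P dvd a \<or> P dvd c" using \<open>prime P\<close> by (simp add: prime_dvd_mult_iff)
  then have "P \<le> \<bar>a\<bar> \<or> P \<le> \<bar>c\<bar>"
    using \<open>a \<noteq> 0\<close> \<open>c \<noteq> 0\<close> by (auto intro: zdvd_imp_le)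
  moreover have "\<not> (\<bar>a\<bar> = P \<and> \<bar>c\<bar> = P)"
  proof
    assume "\<bar>a\<bar> = P \<and> \<bar>c\<bar> = P"
    then have "normalize (a * c) = P\<^sup>2" by (simp add: abs_mult power2_eq_square)
    then have "multiplicity P (a * c) = multiplicity P (P\<^sup>2)"
      by (metis multiplicity_normalize_right)
    also have "\<dots> = 2" using \<open>prime P\<close> by (intro multiplicity_same_power) auto
    finally show False using assms(2) by simp
  qed
  ultimately show thesis using assms(3,4) that by linarith
qed

lemma less_square_if_log_mahler_quadratic_le:
  fixes a b c d P :: int
  assumes "prime P" "P dvd d" and odd_ac: "odd (multiplicity P (a * c))"
    and log_mahler: "log_mahler (cpoly [:c, b, a:]) \<le> ln (real_of_int P)"
    and "a \<noteq> 0" "c \<noteq> 0"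
    and disc: "d dvd b\<^sup>2 - 4 * a * c" "0 < b\<^sup>2 - 4 * a * c" and dvd_ac: "b = 0 \<Longrightarrow> d dvd a * c"
  shows "d < P\<^sup>2"
proof -
  have "P dvd a * c" using odd_ac not_dvd_imp_multiplicity_0 by fastforce
  then have "P dvd (b\<^sup>2 - 4 * a * c) + 4 * (a * c)"
    using dvd_trans[OF \<open>P dvd d\<close> disc(1)] by (intro dvd_add) auto
  then have "P dvd b\<^sup>2" by simp
  then have "P dvd b" using \<open>prime P\<close> prime_dvd_power by blast
  have "\<bar>a\<bar> \<le> P" "\<bar>c\<bar> \<le> P"
    using abs_outer_coeffs_le_if_log_mahler_le[OF log_mahler \<open>a \<noteq> 0\<close> \<open>c \<noteq> 0\<close>]
      prime_gt_0_int[OF \<open>prime P\<close>] by blast+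
  with \<open>prime P\<close> odd_ac show ?thesis
    using \<open>a \<noteq> 0\<close> \<open>c \<noteq> 0\<close>
  proof (cases rule: odd_multiplicity_mult_cases)
    case lead
    then have "\<bar>b\<bar> * \<bar>a\<bar> \<le> a * (a + c)"
      using log_mahler \<open>a \<noteq> 0\<close>
      by (intro abs_middle_coeff_le_if_log_mahler_le_lead_coeff) (auto simp flip: of_int_abs)
    then show ?thesis
      using lead \<open>c \<noteq> 0\<close> \<open>P dvd b\<close> disc dvd_ac
      by (intro less_square_if_dvd_discriminant[of a P c b d]) (simp_all add: mult_ac)
  next
    case const
    then have "\<bar>b\<bar> * \<bar>c\<bar> \<le> c * (c + a)"
      using log_mahler \<open>c \<noteq> 0\<close>
      by (intro abs_middle_coeff_le_if_log_mahler_le_const_coeff) (auto simp flip: of_int_abs)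
    then show ?thesis
      using const \<open>a \<noteq> 0\<close> \<open>P dvd b\<close> disc dvd_ac by (intro less_square_if_dvd_discriminant)
  qed
qed

section \<open>Valuations and denominators of rational numbers\<close>

lemma multiplicity_squarefree_eq_1:
  fixes p n :: "'a::factorial_semiring"
  assumes "squarefree n" "prime p" "p dvd n"
  shows "multiplicity p n = 1"
proof (rule antisym)
  have "n \<noteq> 0" using assms(1) by auto
  then show "multiplicity p n \<le> 1" using assms squarefree_factorial_semiring''[of n] by auto
  show "1 \<le> multiplicity p n"
    using \<open>n \<noteq> 0\<close> assms not_prime_unit by (intro multiplicity_geI) auto
qed

lemma rat_quotientE:
  fixes r :: rat
  obtains u v :: int where "v > 0" "coprime u v" "r = of_int u / of_int v"
  using quotient_of_denom_pos quotient_of_coprime quotient_of_div by (metis surj_pair)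

definition rat_multiplicity :: "int \<Rightarrow> rat \<Rightarrow> int" where
  "rat_multiplicity p q =
     int (multiplicity p (fst (quotient_of q))) - int (multiplicity p (snd (quotient_of q)))"

lemma rat_multiplicity_divide:
  assumes "prime p" "u \<noteq> 0" "v \<noteq> 0"
  shows "rat_multiplicity p (of_int u / of_int v) = int (multiplicity p u) - int (multiplicity p v)"
proof -
  note mult_distrib = prime_elem_multiplicity_mult_distrib[OF prime_imp_prime_elem[OF \<open>prime p\<close>]]
  obtain u' v' where uv': "quotient_of (of_int u / of_int v) = (u', v')" by force
  then have "v' > 0" and "of_int u / of_int v = (of_int u' / of_int v' :: rat)"
    using quotient_of_denom_pos quotient_of_div by blast+
  then have "(of_int (u * v') :: rat) = of_int (u' * v)" using \<open>v \<noteq> 0\<close> by (simp add: field_simps)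
  then have cross: "u * v' = u' * v" by (simp only: of_int_eq_iff)
  then have "u' \<noteq> 0" using assms(2) \<open>v' > 0\<close> by auto
  have "multiplicity p u + multiplicity p v' = multiplicity p (u * v')"
    using assms \<open>v' > 0\<close> by (simp add: mult_distrib)
  also have "\<dots> = multiplicity p u' + multiplicity p v"
    using assms \<open>u' \<noteq> 0\<close> by (simp add: cross mult_distrib)
  finally show ?thesis by (simp add: rat_multiplicity_def uv')
qed

lemma rat_multiplicity_of_int:
  "prime p \<Longrightarrow> n \<noteq> 0 \<Longrightarrow> rat_multiplicity p (of_int n) = int (multiplicity p n)"
  using rat_multiplicity_divide[of p n 1] by simp

lemma rat_multiplicity_mult:
  assumes "prime p" "q \<noteq> 0" "r \<noteq> 0"
  shows "rat_multiplicity p (q * r) = rat_multiplicity p q + rat_multiplicity p r"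
proof -
  note mult_distrib = prime_elem_multiplicity_mult_distrib[OF prime_imp_prime_elem[OF \<open>prime p\<close>]]
  obtain u v where "v > 0" and q_eq: "q = of_int u / of_int v" by (rule rat_quotientE)
  obtain u' v' where "v' > 0" and r_eq: "r = of_int u' / of_int v'" by (rule rat_quotientE)
  have nonzero: "u \<noteq> 0" "u' \<noteq> 0" "v \<noteq> 0" "v' \<noteq> 0"
    using assms \<open>v > 0\<close> \<open>v' > 0\<close> by (auto simp: q_eq r_eq)
  have "rat_multiplicity p (q * r) = rat_multiplicity p (of_int (u * u') / of_int (v * v'))"
    by (simp add: q_eq r_eq)
  also have "\<dots> = int (multiplicity p (u * u')) - int (multiplicity p (v * v'))"
    using assms(1) nonzero by (intro rat_multiplicity_divide) auto
  finally show ?thesis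
    using assms(1) nonzero by (simp add: q_eq r_eq rat_multiplicity_divide mult_distrib)
qed

lemma rat_square_mult_squarefree_eq_int:
  fixes r :: rat and d n :: int
  assumes "squarefree d" "r\<^sup>2 * of_int d = of_int n"
  obtains k where "r = of_int k" "n = k\<^sup>2 * d"
proof -
  obtain u v where "v > 0" "coprime u v" and r_eq: "r = of_int u / of_int v"
    by (rule rat_quotientE)
  have "of_int (u\<^sup>2 * d) = (of_int (n * v\<^sup>2) :: rat)"
    using assms(2) \<open>v > 0\<close> by (simp add: r_eq power_divide field_simps)
  then have cross: "u\<^sup>2 * d = n * v\<^sup>2" by (simp only: of_int_eq_iff)
  then have "v\<^sup>2 dvd u\<^sup>2 * d" by simp
  moreover have "coprime (v\<^sup>2) (u\<^sup>2)" using \<open>coprime u v\<close> by (simp add: coprime_commute)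
  ultimately have "v\<^sup>2 dvd d" by (simp add: coprime_dvd_mult_right_iff)
  then have "v dvd 1" using assms(1) squarefreeD by blast
  then have "v = 1" using \<open>v > 0\<close> by auto
  then show thesis using that[of u] cross by (simp add: r_eq)
qed

lemma rat_common_denominatorE:
  fixes q r :: rat
  obtains d m n :: int where "d \<noteq> 0" "of_int d * q = of_int m" "of_int d * r = of_int n"
proof -
  obtain u v where "v > 0" and q_eq: "q = of_int u / of_int v" by (rule rat_quotientE)
  obtain u' v' where "v' > 0" and r_eq: "r = of_int u' / of_int v'" by (rule rat_quotientE)
  show thesis
  proof
    show "v * v' \<noteq> 0" using \<open>v > 0\<close> \<open>v' > 0\<close> by simp
    show "of_int (v * v') * q = of_int (u * v')" "of_int (v * v') * r = of_int (u' * v)"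
      using \<open>v > 0\<close> \<open>v' > 0\<close> by (simp_all add: q_eq r_eq)
  qed
qed

section \<open>Quadratic fields\<close>

lemma is_complex_subfield_of_nat: "is_complex_subfield K \<Longrightarrow> of_nat n \<in> K"
  by (induction n) (auto simp: is_complex_subfield_def)

lemma rat_adjoin_self: "\<alpha> \<in> rat_adjoin \<alpha>"
  and rat_adjoin_of_nat: "of_nat n \<in> rat_adjoin \<alpha>"
  and rat_adjoin_divide: "x \<in> rat_adjoin \<alpha> \<Longrightarrow> y \<in> rat_adjoin \<alpha> \<Longrightarrow> x / y \<in> rat_adjoin \<alpha>"
  by (auto simp: rat_adjoin_def is_complex_subfield_of_nat is_complex_subfield_def divide_inverse)

locale quadratic_irrational =
  fixes d :: int and \<delta> :: complex
  assumes square: "\<delta>\<^sup>2 = of_int d" and irrational: "\<delta> \<notin> \<rat>"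
begin

definition quad :: "rat \<Rightarrow> rat \<Rightarrow> complex" where
  "quad x y = of_rat x + of_rat y * \<delta>"

definition quad_norm :: "rat \<Rightarrow> rat \<Rightarrow> rat" where
  "quad_norm x y = x\<^sup>2 - of_int d * y\<^sup>2"

lemma nonzero: "\<delta> \<noteq> 0"
  using irrational by auto

lemma quad_eq_0_iff: "quad x y = 0 \<longleftrightarrow> x = 0 \<and> y = 0"
proof
  assume quad_eq: "quad x y = 0"
  have "y = 0"
  proof (rule ccontr)
    assume "y \<noteq> 0"
    then have "\<delta> = of_rat (- x / y)"
      using quad_eq by (simp add: quad_def of_rat_divide of_rat_minus field_simps add_eq_0_iff)
    then show False using irrational Rats_of_rat by metis
  qed
  then show "x = 0 \<and> y = 0" using quad_eq by (simp add: quad_def)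
qed (simp add: quad_def)

lemma quad_of_rat: "quad x 0 = of_rat x"
  by (simp add: quad_def)

lemma quad_add: "quad x y + quad x' y' = quad (x + x') (y + y')"
  by (simp add: quad_def of_rat_add algebra_simps)

lemma quad_uminus: "- quad x y = quad (- x) (- y)"
  by (simp add: quad_def of_rat_minus)

lemma quad_mult: "quad x y * quad x' y' = quad (x * x' + of_int d * (y * y')) (x * y' + y * x')"
proof -
  have "quad x y * quad x' y' = of_rat x * of_rat x' + \<delta>\<^sup>2 * (of_rat y * of_rat y') +
      (of_rat x * of_rat y' + of_rat y * of_rat x') * \<delta>"
    by (simp add: quad_def power2_eq_square algebra_simps)
  then show ?thesis by (simp add: square quad_def of_rat_add of_rat_mult)
qed

lemma quad_norm_mult:
  "quad_norm x y * quad_norm x' y' = quad_norm (x * x' + of_int d * (y * y')) (x * y' + y * x')"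
  by (simp add: quad_norm_def power2_eq_square algebra_simps)

lemma quad_mult_conjugate: "quad x y * quad x (- y) = of_rat (quad_norm x y)"
  unfolding quad_mult by (simp add: quad_def quad_norm_def power2_eq_square)

lemma quad_norm_eq_0_iff: "quad_norm x y = 0 \<longleftrightarrow> x = 0 \<and> y = 0"
proof -
  have "quad_norm x y = 0 \<longleftrightarrow> quad x y * quad x (- y) = 0"
    unfolding quad_mult_conjugate by simp
  also have "\<dots> \<longleftrightarrow> x = 0 \<and> y = 0" by (simp add: quad_eq_0_iff)
  finally show ?thesis .
qed

lemma inverse_quad: "inverse (quad x y) = quad (x / quad_norm x y) (- y / quad_norm x y)"
proof (cases "quad x y = 0")
  case True
  then show ?thesis by (simp add: quad_eq_0_iff) (simp add: quad_def)
next
  case False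
  define N where "N = quad_norm x y"
  have "N \<noteq> 0" using False by (simp add: N_def quad_norm_eq_0_iff quad_eq_0_iff)
  have "quad x y * quad (x / N) (- y / N) = quad x y * quad x (- y) / of_rat N"
    using \<open>N \<noteq> 0\<close> by (simp add: quad_def of_rat_divide of_rat_minus field_simps)
  also have "\<dots> = 1" using \<open>N \<noteq> 0\<close> by (simp add: quad_mult_conjugate N_def)
  finally show ?thesis unfolding N_def by (rule inverse_unique)
qed

lemma is_complex_subfield_quad: "is_complex_subfield {quad x y | x y. True}"
proof -
  have "0 = quad 0 0" "1 = quad 1 0" by (simp_all add: quad_def)
  moreover have "quad x y \<in> {quad x y | x y. True}" for x y by blast
  ultimately show ?thesis
    unfolding is_complex_subfield_def
    by (auto simp: quad_add quad_mult quad_uminus inverse_quad)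
qed

lemma rat_adjoin_quadE:
  assumes "z \<in> rat_adjoin \<delta>"
  obtains x y where "z = quad x y"
proof -
  have "\<delta> = quad 0 1" by (simp add: quad_def)
  then have "rat_adjoin \<delta> \<subseteq> {quad x y | x y. True}"
    using is_complex_subfield_quad unfolding rat_adjoin_def by blast
  then show thesis using assms that by blast
qed

lemma quad_norm_prod_list_even:
  assumes "prime p" "set \<beta>s \<subseteq> rat_adjoin \<delta>" "0 \<notin> set \<beta>s"
    and "\<And>x y. quad x y \<in> set \<beta>s \<Longrightarrow> even (rat_multiplicity p (quad_norm x y))"
  shows "\<exists>x y. prod_list \<beta>s = quad x y \<and> quad_norm x y \<noteq> 0 \<and>
    even (rat_multiplicity p (quad_norm x y))"
  using assms(2-)
proof (induction \<beta>s)
  case Nil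
  have "rat_multiplicity p 1 = 0" using rat_multiplicity_of_int[OF assms(1), of 1] by simp
  then show ?case by (intro exI[of _ 1] exI[of _ 0]) (simp add: quad_def quad_norm_def)
next
  case (Cons \<beta> \<beta>s)
  obtain x y where head: "\<beta> = quad x y"
    using Cons.prems(1) by (auto elim: rat_adjoin_quadE)
  then have "quad_norm x y \<noteq> 0" "even (rat_multiplicity p (quad_norm x y))"
    using Cons.prems(2,3) by (auto simp: quad_norm_eq_0_iff quad_eq_0_iff)
  moreover obtain x' y' where tail: "prod_list \<beta>s = quad x' y'" "quad_norm x' y' \<noteq> 0"
      "even (rat_multiplicity p (quad_norm x' y'))"
    using Cons by auto
  ultimately have "quad_norm x y * quad_norm x' y' \<noteq> 0"
      "even (rat_multiplicity p (quad_norm x y * quad_norm x' y'))"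
    using assms(1) by (simp_all add: rat_multiplicity_mult)
  moreover have "prod_list (\<beta> # \<beta>s) = quad x y * quad x' y'"
    by (simp add: head tail)
  ultimately show ?case unfolding quad_norm_mult quad_mult by blast
qed

lemma ex_factor_odd_norm:
  assumes "prime p" "odd (multiplicity p d)"
    and \<beta>s: "prod_list \<beta>s = \<delta>" "set \<beta>s \<subseteq> rat_adjoin \<delta>"
  obtains x y where "quad x y \<in> set \<beta>s" "odd (rat_multiplicity p (quad_norm x y))"
proof (rule ccontr)
  assume "\<not> thesis"
  then have "\<And>x y. quad x y \<in> set \<beta>s \<Longrightarrow> even (rat_multiplicity p (quad_norm x y))"
    using that by blast
  moreover have "0 \<notin> set \<beta>s" using \<beta>s(1) nonzero by (metis prod_list_zero_iff)
  ultimately obtain x y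
    where \<delta>_eq: "\<delta> = quad x y" and even_norm: "even (rat_multiplicity p (quad_norm x y))"
    using quad_norm_prod_list_even[OF \<open>prime p\<close> \<beta>s(2)] \<beta>s(1) by auto
  have "quad x (y - 1) = quad x y - \<delta>" by (simp add: quad_def of_rat_diff algebra_simps)
  then have "x = 0" "y = 1" using \<delta>_eq quad_eq_0_iff[of x "y - 1"] by auto
  then have "quad_norm x y = of_int (- d)" by (simp add: quad_norm_def)
  moreover have "d \<noteq> 0" using assms(2) by auto
  ultimately have "rat_multiplicity p (quad_norm x y) = int (multiplicity p d)"
    using rat_multiplicity_of_int[OF \<open>prime p\<close>, of "- d"] by (simp add: multiplicity_uminus_right)
  then show False using even_norm assms(2) by simp
qed

lemma quad_root_iff:
  assumes "y \<noteq> 0"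
  shows "poly (cpoly [:c, b, a:]) (quad x y) = 0 \<longleftrightarrow>
    of_int b = - (2 * of_int a * x) \<and> of_int c = of_int a * quad_norm x y"
proof -
  have "poly (cpoly [:c, b, a:]) (quad x y) =
      quad (of_int c) 0 + quad x y * (quad (of_int b) 0 + quad x y * quad (of_int a) 0)"
    by (simp add: Polynomial.map_poly_pCons quad_of_rat)
  also have "\<dots> = quad (of_int c + of_int b * x + of_int a * (x * x + of_int d * (y * y)))
      (y * (of_int b - - (2 * of_int a * x)))"
    unfolding quad_add quad_mult by (rule arg_cong2[of _ _ _ _ quad]) (simp_all add: algebra_simps)
  also have "\<dots> = 0 \<longleftrightarrow> of_int b = - (2 * of_int a * x) \<and>
      of_int c + of_int b * x + of_int a * (x * x + of_int d * (y * y)) = 0"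
    unfolding quad_eq_0_iff using assms by (simp only: mult_eq_0_iff right_minus_eq) blast
  also have "\<dots> \<longleftrightarrow> of_int b = - (2 * of_int a * x) \<and> of_int c = of_int a * quad_norm x y"
  proof (rule conj_cong[OF refl])
    assume b_eq: "of_int b = - (2 * of_int a * x)"
    have "of_int c + of_int b * x + of_int a * (x * x + of_int d * (y * y)) =
        of_int c - of_int a * quad_norm x y"
      unfolding b_eq by (simp add: quad_norm_def power2_eq_square algebra_simps)
    then show "of_int c + of_int b * x + of_int a * (x * x + of_int d * (y * y)) = 0 \<longleftrightarrow>
        of_int c = of_int a * quad_norm x y"
      by (simp only: right_minus_eq)
  qed
  finally show ?thesis .
qed

lemma min_int_poly_quad:
  assumes "y \<noteq> 0"
  obtains a b c where "min_int_poly (quad x y) = [:c, b, a:]" "a \<noteq> 0" "c \<noteq> 0"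
    "of_int b = - (2 * of_int a * x)" "of_int c = of_int a * quad_norm x y"
proof -
  define f where "f = min_int_poly (quad x y)"
  obtain z m n where "z \<noteq> 0"
    and cleared: "of_int z * - (2 * x) = of_int m" "of_int z * quad_norm x y = of_int n"
    by (rule rat_common_denominatorE)
  then have root: "poly (cpoly [:n, m, z:]) (quad x y) = 0"
    unfolding quad_root_iff[OF assms] by (simp flip: cleared)
  have "[:n, m, z:] \<noteq> 0" using \<open>z \<noteq> 0\<close> by simp
  then have "algebraic (quad x y)" using root by (rule algebraic_if_root)
  have "f dvd [:n, m, z:]"
    unfolding f_def using \<open>[:n, m, z:] \<noteq> 0\<close> root by (rule min_int_poly_dvd)
  then have "degree f \<le> degree [:n, m, z:]" using \<open>[:n, m, z:] \<noteq> 0\<close> by (rule dvd_imp_degree_le)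
  then have "degree f \<le> 2" using \<open>z \<noteq> 0\<close> by simp
  then have f_eq: "f = [:coeff f 0, coeff f 1, coeff f 2:]"
    by (intro poly_eqI) (auto simp: coeff_pCons coeff_eq_0 numeral_2_eq_2 split: nat.splits)
  have "poly (cpoly f) (quad x y) = 0"
    unfolding f_def using \<open>algebraic (quad x y)\<close> by (rule min_int_poly_root)
  then have coeffs: "of_int (coeff f 1) = - (2 * of_int (coeff f 2) * x)"
      "of_int (coeff f 0) = of_int (coeff f 2) * quad_norm x y"
    using quad_root_iff[OF assms] f_eq by metis+
  have "coeff f 0 \<noteq> 0"
    unfolding f_def using \<open>algebraic (quad x y)\<close> assms
    by (intro coeff_0_min_int_poly_nonzero) (simp_all add: quad_eq_0_iff)
  moreover from this have "coeff f 2 \<noteq> 0" using coeffs(2) by auto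
  ultimately show thesis using that coeffs f_eq unfolding f_def by blast
qed

lemma min_int_poly_quad_discriminant:
  assumes "squarefree d" "d > 0" "y \<noteq> 0"
  obtains a b c where "min_int_poly (quad x y) = [:c, b, a:]" "a \<noteq> 0" "c \<noteq> 0"
    "quad_norm x y = of_int c / of_int a"
    "d dvd b\<^sup>2 - 4 * a * c" "0 < b\<^sup>2 - 4 * a * c" "b = 0 \<Longrightarrow> d dvd a * c"
proof -
  obtain a b c where min_poly: "min_int_poly (quad x y) = [:c, b, a:]" and "a \<noteq> 0" "c \<noteq> 0"
    and b_eq: "of_int b = - (2 * of_int a * x)" and c_eq: "of_int c = of_int a * quad_norm x y"
    using \<open>y \<noteq> 0\<close> by (rule min_int_poly_quad)
  have "rat_of_int (b\<^sup>2 - 4 * a * c) = (of_int b)\<^sup>2 - 4 * of_int a * of_int c" by simp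
  also have "\<dots> = (2 * of_int a)\<^sup>2 * (x\<^sup>2 - quad_norm x y)"
    unfolding b_eq c_eq
    by (simp add: power_mult_distrib right_diff_distrib) (simp add: power2_eq_square)
  also have "\<dots> = (2 * of_int a * y)\<^sup>2 * of_int d"
    by (simp add: quad_norm_def power_mult_distrib)
  finally obtain k
    where k_eq: "2 * of_int a * y = of_int k" and disc: "b\<^sup>2 - 4 * a * c = k\<^sup>2 * d"
    using rat_square_mult_squarefree_eq_int[OF \<open>squarefree d\<close>] by metis
  have "k \<noteq> 0" using k_eq \<open>a \<noteq> 0\<close> \<open>y \<noteq> 0\<close> by auto
  then have "0 < b\<^sup>2 - 4 * a * c" unfolding disc using \<open>d > 0\<close> by simp
  moreover have "d dvd b\<^sup>2 - 4 * a * c" unfolding disc by simp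
  moreover have "d dvd a * c" if "b = 0"
  proof -
    have "x = 0" using b_eq that \<open>a \<noteq> 0\<close> by simp
    then have "(of_int a * y)\<^sup>2 * of_int d = of_int (- (a * c))"
      using c_eq by (simp add: quad_norm_def power2_eq_square)
    then obtain l where "- (a * c) = l\<^sup>2 * d"
      using rat_square_mult_squarefree_eq_int[OF \<open>squarefree d\<close>] by blast
    then have "d dvd - (a * c)" by simp
    then show ?thesis by simp
  qed
  moreover have "quad_norm x y = of_int c / of_int a" using c_eq \<open>a \<noteq> 0\<close> by simp
  ultimately show thesis using that min_poly \<open>a \<noteq> 0\<close> \<open>c \<noteq> 0\<close> by blast
qed

lemma less_prime_square_if_bounded_factorization:
  assumes "squarefree d" "d > 0" "prime P" "P dvd d"
    and \<beta>s: "prod_list \<beta>s = \<delta>" "set \<beta>s \<subseteq> rat_adjoin \<delta>"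
    and bound: "\<And>\<beta>. \<beta> \<in> set \<beta>s \<Longrightarrow> log_mahler_alg \<beta> \<le> ln (real_of_int P)"
  shows "d < P\<^sup>2"
proof -
  have "odd (multiplicity P d)" using assms(1,3,4) by (simp add: multiplicity_squarefree_eq_1)
  then obtain x y where mem: "quad x y \<in> set \<beta>s"
    and odd_norm: "odd (rat_multiplicity P (quad_norm x y))"
    using ex_factor_odd_norm[OF \<open>prime P\<close> _ \<beta>s] by auto
  have "0 \<notin> set \<beta>s" using \<beta>s(1) nonzero by (metis prod_list_zero_iff)
  then have "x \<noteq> 0 \<or> y \<noteq> 0" using mem quad_eq_0_iff[of x y] by auto
  have "y \<noteq> 0"
  proof
    assume "y = 0"
    with \<open>x \<noteq> 0 \<or> y \<noteq> 0\<close> have "rat_multiplicity P (quad_norm x y) = 2 * rat_multiplicity P x"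
      using \<open>prime P\<close> by (simp add: quad_norm_def power2_eq_square rat_multiplicity_mult)
    then show False using odd_norm by simp
  qed
  obtain a b c where min_poly: "min_int_poly (quad x y) = [:c, b, a:]"
    and "a \<noteq> 0" "c \<noteq> 0" and norm_eq: "quad_norm x y = of_int c / of_int a"
    and disc: "d dvd b\<^sup>2 - 4 * a * c" "0 < b\<^sup>2 - 4 * a * c" "b = 0 \<Longrightarrow> d dvd a * c"
    using min_int_poly_quad_discriminant[OF assms(1,2) \<open>y \<noteq> 0\<close>, of x] by blast
  have "multiplicity P (a * c) = multiplicity P a + multiplicity P c"
    using \<open>prime P\<close> \<open>a \<noteq> 0\<close> \<open>c \<noteq> 0\<close>
    by (intro prime_elem_multiplicity_mult_distrib) auto
  then have "odd (multiplicity P (a * c))"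
    using odd_norm \<open>prime P\<close> \<open>a \<noteq> 0\<close> \<open>c \<noteq> 0\<close> unfolding norm_eq
    by (simp add: rat_multiplicity_divide)
  moreover have "log_mahler (cpoly [:c, b, a:]) \<le> ln (real_of_int P)"
    using bound[OF mem] unfolding log_mahler_alg_def min_poly .
  ultimately show ?thesis
    using assms(3,4) \<open>a \<noteq> 0\<close> \<open>c \<noteq> 0\<close> disc
    by (intro less_square_if_log_mahler_quadratic_le)
qed

end

section \<open>Square roots of squarefree integers\<close>

lemma prod_dvd_if_pairwise_coprime:
  fixes f :: "'a \<Rightarrow> 'b::semiring_gcd"
  assumes "\<And>i. i \<in> S \<Longrightarrow> f i dvd n"
    and "\<And>i j. i \<in> S \<Longrightarrow> j \<in> S \<Longrightarrow> i \<noteq> j \<Longrightarrow> coprime (f i) (f j)"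
  shows "prod f S dvd n"
  using assms
proof (induction S rule: infinite_finite_induct)
  case (insert i S)
  have "coprime (f i) (prod f S)"
    using insert by (intro prod_coprime_right) auto
  then show ?case using insert by (auto intro: divides_mult)
qed auto

locale distinct_primes =
  fixes I :: "'i set" and p :: "'i \<Rightarrow> nat" and m :: 'i and D :: nat and \<delta> :: complex
  assumes finite_I: "finite I" and prime_p: "\<And>i. i \<in> I \<Longrightarrow> prime (p i)" and inj_p: "inj_on p I"
    and m_mem: "m \<in> I" and p_le: "\<And>i. i \<in> I \<Longrightarrow> p i \<le> p m"
    and D_eq: "D = (\<Prod>i\<in>I. p i)" and \<delta>_eq: "\<delta> = complex_of_real (sqrt (real D))"
begin

abbreviation log_primes_norm :: "ereal \<Rightarrow> real" where
  "log_primes_norm t \<equiv> lp_norm t (\<lambda>i. ln (real (p i))) I"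

lemma I_nonempty: "I \<noteq> {}"
  using m_mem by blast

lemma p_pos: "i \<in> I \<Longrightarrow> 0 < p i"
  using prime_p prime_gt_0_nat by blast

lemma ln_p_bounds:
  assumes "i \<in> I"
  shows "0 \<le> ln (real (p i))" and "ln (real (p i)) \<le> ln (real (p m))"
  using p_pos[OF assms] p_le[OF assms] by (auto intro!: ln_mono)

lemma coprime_p: "i \<in> I \<Longrightarrow> j \<in> I \<Longrightarrow> i \<noteq> j \<Longrightarrow> coprime (p i) (p j)"
  using prime_p inj_p by (auto intro!: primes_coprime dest: inj_onD)

lemma D_pos: "0 < D"
  unfolding D_eq using p_pos by (intro prod_pos)

lemma p_dvd_D: "i \<in> I \<Longrightarrow> p i dvd D"
  unfolding D_eq using finite_I by (rule dvd_prodI)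

lemma \<delta>_square: "\<delta>\<^sup>2 = of_nat D"
  by (simp add: \<delta>_eq flip: of_real_power)

lemma squarefree_D: "squarefree (int D)"
  unfolding D_eq of_nat_prod
  using prime_p coprime_p by (intro squarefree_prod_coprime) (auto intro!: squarefree_prime)

lemma \<delta>_irrational: "\<delta> \<notin> \<rat>"
proof
  assume "\<delta> \<in> \<rat>"
  then obtain r where \<delta>_eq_rat: "\<delta> = of_rat r" by (elim Rats_cases)
  have "of_rat (r\<^sup>2) = (of_rat (of_nat D) :: complex)"
    using \<delta>_square by (simp add: \<delta>_eq_rat of_rat_power)
  then have "r\<^sup>2 = of_nat D" by (simp only: of_rat_eq_iff)
  then have "(1 / r)\<^sup>2 * of_int (int D) = of_int 1"
    using D_pos by (simp add: power_divide)
  then obtain k where "1 = k\<^sup>2 * int D"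
    using rat_square_mult_squarefree_eq_int[OF squarefree_D] by blast
  then have "int D dvd 1" by (metis dvd_triv_right)
  then have "p m dvd 1" using p_dvd_D[OF m_mem] by simp
  then show False using prime_p[OF m_mem] not_prime_unit by blast
qed

sublocale quadratic_irrational "int D" \<delta>
  using \<delta>_square \<delta>_irrational by unfold_locales auto

lemma prime_assignmentE:
  assumes "is_factorization \<delta> \<beta>s"
  obtains n where
    "\<And>i. i \<in> I \<Longrightarrow> n i < length \<beta>s \<and> int (p i) dvd coeff (min_int_poly (\<beta>s ! n i)) 0"
proof -
  have "\<exists>k<length \<beta>s. int (p i) dvd coeff (min_int_poly (\<beta>s ! k)) 0" if "i \<in> I" for i
  proof -
    have "\<exists>\<beta>\<in>set \<beta>s. int (p i) dvd coeff (min_int_poly \<beta>) 0"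
    proof (rule prime_dvd_const_coeff_if_prod_list_square)
      show "(prod_list \<beta>s)\<^sup>2 = of_int (int D)"
        using \<delta>_square assms by (simp add: is_factorization_def)
      show "poly (cpoly (min_int_poly \<beta>)) \<beta> = 0" if "\<beta> \<in> set \<beta>s" for \<beta>
        using that assms by (intro min_int_poly_root) (auto simp: is_factorization_def)
    qed (use that prime_p p_dvd_D D_pos in auto)
    then show ?thesis by (auto simp: in_set_conv_nth)
  qed
  then show thesis using that by metis
qed

lemma sum_ln_primes_le_log_mahler_alg:
  assumes "algebraic \<beta>" "\<beta> \<noteq> 0" "S \<subseteq> I"
    and dvd: "\<And>i. i \<in> S \<Longrightarrow> int (p i) dvd coeff (min_int_poly \<beta>) 0"
  shows "(\<Sum>i\<in>S. ln (real (p i))) \<le> log_mahler_alg \<beta>"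
proof -
  have "(\<Prod>i\<in>S. int (p i)) dvd coeff (min_int_poly \<beta>) 0"
    using dvd coprime_p \<open>S \<subseteq> I\<close> by (intro prod_dvd_if_pairwise_coprime) auto
  then have "ln (real (\<Prod>i\<in>S. p i)) \<le> log_mahler_alg \<beta>"
    using assms(1-3) p_pos
    by (intro ln_le_log_mahler_alg_if_dvd_const_coeff prod_pos) auto
  also have "ln (real (\<Prod>i\<in>S. p i)) = (\<Sum>i\<in>S. ln (real (p i)))"
    using finite_subset[OF \<open>S \<subseteq> I\<close> finite_I] \<open>S \<subseteq> I\<close> p_pos
    by (subst of_nat_prod, subst ln_prod) auto
  finally show ?thesis .
qed

lemma prime_groupingE:
  assumes "is_factorization \<delta> \<beta>s"
  obtains n where "\<And>i. i \<in> I \<Longrightarrow> n i \<in> {..<length \<beta>s}"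
    and "\<And>k. k \<in> {..<length \<beta>s} \<Longrightarrow>
      (\<Sum>i | i \<in> I \<and> n i = k. ln (real (p i))) \<le> log_mahler_alg (\<beta>s ! k)"
proof -
  obtain n where assignment:
    "\<And>i. i \<in> I \<Longrightarrow> n i < length \<beta>s \<and> int (p i) dvd coeff (min_int_poly (\<beta>s ! n i)) 0"
    using prime_assignmentE[OF assms] by blast
  show thesis
  proof
    fix k assume "k \<in> {..<length \<beta>s}"
    then show "(\<Sum>i | i \<in> I \<and> n i = k. ln (real (p i))) \<le> log_mahler_alg (\<beta>s ! k)"
      using assms assignment
      by (intro sum_ln_primes_le_log_mahler_alg) (auto simp: is_factorization_def)
  qed (use assignment in auto)
qed

lemma log_primes_norm_le_mahler_lt:
  assumes "is_factorization \<delta> \<beta>s" "t \<ge> 1"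
  shows "log_primes_norm t \<le> mahler_lt t \<beta>s"
proof -
  obtain n where "\<And>i. i \<in> I \<Longrightarrow> n i \<in> {..<length \<beta>s}"
    "\<And>k. k \<in> {..<length \<beta>s} \<Longrightarrow>
      (\<Sum>i | i \<in> I \<and> n i = k. ln (real (p i))) \<le> log_mahler_alg (\<beta>s ! k)"
    using prime_groupingE[OF assms(1)] by blast
  then show ?thesis
    unfolding mahler_lt_eq_lp_norm
    using finite_I I_nonempty ln_p_bounds(1) \<open>t \<ge> 1\<close> by (intro lp_norm_le_if_grouped) auto
qed

lemma log_mahler_alg_le_if_mahler_lt_le:
  assumes "is_factorization \<delta> \<beta>s" "t > 1" "\<beta> \<in> set \<beta>s"
    and optimal: "mahler_lt t \<beta>s \<le> log_primes_norm t"
  shows "log_mahler_alg \<beta> \<le> ln (real (p m))"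
proof -
  obtain n where group_mem: "\<And>i. i \<in> I \<Longrightarrow> n i \<in> {..<length \<beta>s}"
    and group_sum_le: "\<And>k. k \<in> {..<length \<beta>s} \<Longrightarrow>
      (\<Sum>i | i \<in> I \<and> n i = k. ln (real (p i))) \<le> log_mahler_alg (\<beta>s ! k)"
    using prime_groupingE[OF assms(1)] by blast
  obtain k where "k < length \<beta>s" "\<beta> = \<beta>s ! k"
    using \<open>\<beta> \<in> set \<beta>s\<close> by (auto simp: in_set_conv_nth)
  have "log_mahler_alg (\<beta>s ! k) \<le> ln (real (p m))"
  proof (rule le_if_lp_norm_le_if_grouped[where n = n and k = k
        and y = "\<lambda>k. log_mahler_alg (\<beta>s ! k)"])
    show "lp_norm t (\<lambda>k. log_mahler_alg (\<beta>s ! k)) {..<length \<beta>s} \<le> log_primes_norm t"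
      using optimal unfolding mahler_lt_eq_lp_norm .
  qed (use finite_I I_nonempty group_mem group_sum_le ln_p_bounds \<open>t > 1\<close> \<open>k < length \<beta>s\<close> in auto)
  then show ?thesis using \<open>\<beta> = \<beta>s ! k\<close> by simp
qed

lemma attained_by_map:
  assumes ks: "distinct ks" "set ks = I" and "t > 1" and prod_h: "prod h I = \<delta>"
    and h_bound: "\<And>i. i \<in> I \<Longrightarrow> algebraic (h i) \<and> log_mahler_alg (h i) \<le> ln (real (p i))"
  shows "attained_by t \<delta> (map h ks)"
    and "metric_mahler t \<delta> = log_primes_norm t"
proof -
  have "0 \<notin> h ` I" using prod_h nonzero finite_I by auto
  moreover have "prod_list (map h ks) = \<delta>"
    using prod.distinct_set_conv_list[OF ks(1), of h] ks(2) prod_h by simp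
  ultimately have factorization: "is_factorization \<delta> (map h ks)"
    using h_bound ks(2) I_nonempty by (auto simp: is_factorization_def)
  have "mahler_lt t (map h ks) \<le> log_primes_norm t"
    unfolding mahler_lt_map_eq_lp_norm[OF ks(1)] ks(2)
    using finite_I I_nonempty h_bound log_mahler_alg_nonneg \<open>t > 1\<close> by (intro lp_norm_mono) auto
  then have mahler_lt_eq: "mahler_lt t (map h ks) = log_primes_norm t"
    using log_primes_norm_le_mahler_lt[OF factorization, of t] \<open>t > 1\<close> by simp
  show "metric_mahler t \<delta> = log_primes_norm t"
    unfolding metric_mahler_def
  proof (rule cInf_eq_minimum)
    show "log_primes_norm t \<in> {mahler_lt t \<beta>s | \<beta>s. is_factorization \<delta> \<beta>s}"
      using factorization mahler_lt_eq by force
  qed (use log_primes_norm_le_mahler_lt \<open>t > 1\<close> in auto)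
  then show "attained_by t \<delta> (map h ks)"
    using factorization mahler_lt_eq by (simp add: attained_by_def)
qed

lemma metric_mahler_eq:
  assumes "t > 1"
  shows "metric_mahler t \<delta> = log_primes_norm t"
proof -
  obtain ks where ks: "distinct ks" "set ks = I" using finite_distinct_list[OF finite_I] by blast
  let ?h = "\<lambda>i. complex_of_real (sqrt (real (p i)))"
  show ?thesis
  proof (rule attained_by_map(2)[OF ks assms])
    show "prod ?h I = \<delta>"
      using finite_I unfolding \<delta>_eq D_eq by (induction I) (simp_all add: real_sqrt_mult)
    fix i assume "i \<in> I"
    have "of_nat 1 * (?h i)\<^sup>2 = of_nat (p i)" by (simp flip: of_real_power)
    then show "algebraic (?h i) \<and> log_mahler_alg (?h i) \<le> ln (real (p i))"
      using algebraic_square_root_quotient[of "p i" 1 "?h i"]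
        log_mahler_alg_square_root_quotient_le[of "p i" 1 "?h i"]
        p_pos[OF \<open>i \<in> I\<close>] ln_p_bounds(1)[OF \<open>i \<in> I\<close>] by simp
  qed
qed

lemma attained_in_rat_adjoin_imp_less_square:
  assumes "attained_in t \<delta> (rat_adjoin \<delta>)" "t > 1"
  shows "D < (p m)\<^sup>2"
proof -
  obtain \<beta>s where \<beta>s: "set \<beta>s \<subseteq> rat_adjoin \<delta>" "is_factorization \<delta> \<beta>s"
      "metric_mahler t \<delta> = mahler_lt t \<beta>s"
    using assms(1) unfolding attained_in_def attained_by_def by blast
  have "log_mahler_alg \<beta> \<le> ln (real (p m))" if "\<beta> \<in> set \<beta>s" for \<beta>
    using log_mahler_alg_le_if_mahler_lt_le[OF \<beta>s(2) assms(2) that]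
    by (simp add: metric_mahler_eq[OF assms(2)] flip: \<beta>s(3))
  then have "int D < (int (p m))\<^sup>2"
    using \<beta>s squarefree_D D_pos prime_p[OF m_mem] p_dvd_D[OF m_mem]
    by (intro less_prime_square_if_bounded_factorization) (auto simp: is_factorization_def)
  then show ?thesis by (simp flip: of_nat_power)
qed

definition cofactor :: nat where
  "cofactor = (\<Prod>i\<in>I - {m}. p i)"

definition optimal_point :: "'i \<Rightarrow> complex" where
  "optimal_point i =
     (if i = m then complex_of_real (sqrt (real (p m) / real cofactor)) else of_nat (p i))"

lemma D_eq_mult_cofactor: "D = p m * cofactor"
  unfolding D_eq cofactor_def using finite_I m_mem by (rule prod.remove)

lemma cofactor_pos: "0 < cofactor"
  unfolding cofactor_def using p_pos by (intro prod_pos) auto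

lemma optimal_point_m: "optimal_point m = \<delta> / of_nat cofactor"
proof -
  have "real (p m) / real cofactor = real D / (real cofactor)\<^sup>2"
    using cofactor_pos by (simp add: D_eq_mult_cofactor power2_eq_square)
  then show ?thesis by (simp add: optimal_point_def \<delta>_eq real_sqrt_divide)
qed

lemma optimal_point_in_rat_adjoin: "optimal_point i \<in> rat_adjoin \<delta>"
proof (cases "i = m")
  case True
  then show ?thesis
    using optimal_point_m rat_adjoin_divide rat_adjoin_self rat_adjoin_of_nat by metis
qed (simp add: optimal_point_def rat_adjoin_of_nat)

lemma prod_optimal_point: "prod optimal_point I = \<delta>"
proof -
  have "prod optimal_point I = optimal_point m * (\<Prod>i\<in>I - {m}. optimal_point i)"
    using finite_I m_mem by (rule prod.remove)
  also have "(\<Prod>i\<in>I - {m}. optimal_point i) = of_nat cofactor"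
    by (simp add: optimal_point_def cofactor_def)
  finally show ?thesis using cofactor_pos by (simp add: optimal_point_m)
qed

lemma optimal_points_attain:
  assumes "D < (p m)\<^sup>2" "distinct ks" "set ks = I" "t > 1"
  shows "attained_by t \<delta> (map optimal_point ks)"
proof (rule attained_by_map(1)[OF assms(2-4) prod_optimal_point])
  fix i assume "i \<in> I"
  show "algebraic (optimal_point i) \<and> log_mahler_alg (optimal_point i) \<le> ln (real (p i))"
  proof (cases "i = m")
    case True
    have "cofactor < p m"
      using assms(1) by (simp add: D_eq_mult_cofactor power2_eq_square)
    have "(optimal_point m)\<^sup>2 = of_nat D / (of_nat cofactor)\<^sup>2"
      by (simp add: optimal_point_m power_divide \<delta>_square)
    then have "of_nat cofactor * (optimal_point m)\<^sup>2 = of_nat (p m)"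
      using cofactor_pos by (simp add: D_eq_mult_cofactor power2_eq_square)
    then show ?thesis
      using algebraic_square_root_quotient[of "p m" cofactor "optimal_point m"]
        log_mahler_alg_square_root_quotient_le[of "p m" cofactor "optimal_point m"]
        True p_pos[OF m_mem] cofactor_pos \<open>cofactor < p m\<close> by simp
  next
    case False
    then show ?thesis
      using p_pos[OF \<open>i \<in> I\<close>] log_mahler_alg_of_nat_le by (simp add: optimal_point_def)
  qed
qed

lemma log_primes_norm_infinity: "log_primes_norm \<infinity> = ln (real (p m))"
  unfolding lp_norm_def using finite_I m_mem ln_p_bounds(2) by (auto intro!: Max_eqI)

end

theorem theorem1p3:
  fixes p :: "nat \<Rightarrow> nat" and L D :: nat and t :: ereal
    and \<delta> :: complex and pts :: "complex list"
  assumes "L \<ge> 1"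
    and "\<forall>l\<in>{1..L}. prime (p l)"
    and "\<forall>k\<in>{1..L}. \<forall>l\<in>{1..L}. k < l \<longrightarrow> p k > p l"
    and "D = (\<Prod>l=1..L. p l)"
    and "t > 1"
    and "\<delta> = complex_of_real (sqrt (real D))"
    and "pts = complex_of_real (sqrt (real (p 1) / real (\<Prod>l=2..L. p l)))
                 # map (\<lambda>l. of_nat (p l)) [2..<Suc L]"
  shows "(attained_in t \<delta> (rat_adjoin \<delta>) \<longleftrightarrow> D < (p 1)\<^sup>2) \<and>
    (D < (p 1)\<^sup>2 \<longrightarrow>
       set pts \<subseteq> rat_adjoin \<delta> \<and>
       attained_by t \<delta> pts \<and>
       (t < \<infinity> \<longrightarrow> metric_mahler t \<delta> =
          (\<Sum>l=1..L. ln (real (p l)) powr real_of_ereal t) powr (1 / real_of_ereal t)) \<and>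
       (t = \<infinity> \<longrightarrow> metric_mahler t \<delta> = ln (real (p 1))))"
proof -
  interpret distinct_primes "{1..L}" p 1 D \<delta>
  proof
    show "inj_on p {1..L}" using assms(3) by (intro linorder_inj_onI) (auto simp: neq_iff)
    show "p l \<le> p 1" if "l \<in> {1..L}" for l
      using that assms(1,3) by (cases "l = 1") (auto intro: less_imp_le)
  qed (use assms in auto)
  have "[1..<Suc L] = 1 # [2..<Suc L]" "{1..L} - {1} = {2..L}"
    using assms(1) upt_conv_Cons[of 1 "Suc L"] by (auto simp: numeral_2_eq_2 simp del: upt_Suc)
  then have "pts = map optimal_point [1..<Suc L]"
    by (simp add: assms(7) optimal_point_def cofactor_def del: upt_Suc One_nat_def)
  then have pts: "set pts \<subseteq> rat_adjoin \<delta>" "D < (p 1)\<^sup>2 \<Longrightarrow> attained_by t \<delta> pts"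
    using optimal_point_in_rat_adjoin optimal_points_attain[of "[1..<Suc L]"] assms(5)
    by (auto simp: atLeastLessThanSuc_atLeastAtMost simp del: upt_Suc)
  then have "attained_in t \<delta> (rat_adjoin \<delta>) \<longleftrightarrow> D < (p 1)\<^sup>2"
    using attained_in_rat_adjoin_imp_less_square assms(5) by (auto simp: attained_in_def)
  then show ?thesis
    using pts metric_mahler_eq[OF assms(5)] log_primes_norm_infinity by (auto simp: lp_norm_def)
qed

end
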